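(* Let $f\in\mathbb{F}_2[x]$ be irreducible with $\deg(f)=m$. Suppose that $\boldsymbol g^*=(g_1^*,\ldots,g_s^* )\in G_m^s$ is constructed by the following component-by-component algorithm: $g_1^*=1$; and for $d=2,3,\ldots,s$, with $g_1^*,\ldots,g_{d-1}^*$ already chosen, $g_d^*\in G_m$ is a minimizer of $B_{\boldsymbol\gamma}((g_1^*,\ldots,g_{d-1}^*,g_d),f)$ as a function of $g_d$ over $G_m$. (i) Assume there exists a $\delta\in(0,1)$ such that $$C_{\mathrm{Poly}}(\delta,\boldsymbol\gamma):=\sup_{s\in\mathbb{N}}\sum_{\emptyset\ne\mathfrak u\subseteq[s]}\gamma_{\mathfrak u}\prod_{i\in\mathfrak u}\left[\max\left(2,\frac{|\mathfrak u|}{\mathrm e\,\delta\,2\ln2}\right)(b_i-a_i)\right]<\infty.$$ Then $$\mathrm{wce}(\mathcal P(\boldsymbol g^*,f);\infty,s,\boldsymbol\gamma,\varphi)\le\frac{2\,C_{\mathrm{Poly}}(\delta,\boldsymbol\gamma)}{2^{m(1-\delta)}}.$$ (ii) For strictly positive weights $\gamma_{\mathfrak u}$, if $$S(\boldsymbol\gamma):=\sum_{i=1}^\infty(b_i-a_i)\max_{\mathfrak v\subseteq[i-1]}\frac{\gamma_{\mathfrak v\cup\{i\}}}{\gamma_{\mathfrak v}}<\infty,$$ where in this expression $\gamma_\emptyset:=1$, then for any $\delta\in\left(0,\min\left\{1,\frac{5\,S(\boldsymbol\gamma)}{\ln2}\right\}\right)$ we have $$\mathrm{wce}(\mathcal P(\boldsymbol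 g^*,f);\infty,s,\boldsymbol\gamma,\varphi)\le\frac{C_{\mathrm{Poly,prod}}(\delta,\boldsymbol\gamma)}{2^{m(1-\delta)}},\qquad C_{\mathrm{Poly,prod}}(\delta,\boldsymbol\gamma)=\left[\frac{5\,S(\boldsymbol\gamma)}{\delta\ln2}\right]^b,$$ where the integer $b\ge0$ is such that $$\sum_{i=b+1}^\infty(b_i-a_i)\max_{\mathfrak v\subseteq[i-1]}\frac{\gamma_{\mathfrak v\cup\{i\}}}{\gamma_{\mathfrak v}}<\frac{\delta\ln2}5$$ (again with $\gamma_\emptyset:=1$).
   Context: Notation: $\ln$ is the natural logarithm, $\mathrm e$ Euler's number, $[d]=\{1,\ldots,d\}$, $[0]=\emptyset$, $s,m\in\mathbb{N}$. Setting. There are given sequences of reals $-\infty<a_i<b_i<\infty$, $i\in\mathbb{N}$, probability density functions $\varphi_i:[a_i,b_i]\to\mathbb{R}$ (with respect to Lebesgue measure) whose distribution functions $\Phi_i(x)=\int_{a_i}^x\varphi_i(y)\,\mathrm dy$ are invertible as maps $[a_i,b_i]\to[0,1]$, and positive weights $\boldsymbol\gamma=\{\gamma_{\mathfrak u}\}$ indexed by the finite sets $\mathfrak u\subset\mathbb{N}$. In dimension $s$: $[\boldsymbol a,\boldsymbol b]=\prod_{i=1}^s[a_i,b_i]$, $\varphi(\boldsymbol x)=\prod_{i=1}^s\varphi_i(x_i)$, $\Phi^{-1}(\boldsymbol x)=(\Phi_1^{-1}(x_1),\ldots,\Phi_s^{-1}(x_s))$. Norm and worst-case error ($p=\infty$).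 For $\mathfrak u=\{u_1<\cdots<u_k\}\subseteq[s]$ let $\frac{\partial^{|\mathfrak u|}F}{\partial\boldsymbol x_{\mathfrak u}}=\frac{\partial^kF}{\partial x_{u_1}\cdots\partial x_{u_k}}$ (equal to $F$ for $\mathfrak u=\emptyset$). For $F:[\boldsymbol a,\boldsymbol b]\to\mathbb{R}$ for which these mixed partial derivatives exist, $\|F\|_{\infty,s,\boldsymbol\gamma}=\max_{\mathfrak u\subseteq[s]}\frac1{\gamma_{\mathfrak u}}\sup_{\boldsymbol x\in[\boldsymbol a,\boldsymbol b]}\left|\frac{\partial^{|\mathfrak u|}F}{\partial\boldsymbol x_{\mathfrak u}}(\boldsymbol x)\right|$. For points $\mathcal P=\{\boldsymbol y_0,\ldots,\boldsymbol y_{N-1}\}$ in $[0,1]^s$ (counted with multiplicity), $\mathrm{wce}(\mathcal P;\infty,s,\boldsymbol\gamma,\varphi)=\sup_{\|F\|_{\infty,s,\boldsymbol\gamma}\le1}\left|\frac1N\sum_{n=0}^{N-1}F(\Phi^{-1}(\boldsymbol y_n))-\int_{[\boldsymbol a,\boldsymbol b]}F(\boldsymbol x)\varphi(\boldsymbol x)\,\mathrm d\boldsymbol x\right|$. Polynomial lattice point sets. $G_m=\{h\in\mathbb{F}_2[x]:\deg(h)<m\}$ (including $0$). For a formal Laurent series $g=\sum_{k=w}^\infty a_kx^{-k}\in\mathbb{F}_2((x^{-1}))$ let $\{g\}_m=\sum_{k=\max(1,w)}^ma_k2^{-k}\in[0,1)$ (and $\{0\}_m=0$). For $f\in\mathbb{F}_2[x]$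 with $\deg f=m$ and $\boldsymbol g=(g_1,\ldots,g_d)\in\mathbb{F}_2[x]^d$, the polynomial lattice point set $\mathcal P(\boldsymbol g,f)$ consists of the $2^m$ points (counted with multiplicity) $\boldsymbol x_h=(\{hg_1/f\}_m,\ldots,\{hg_d/f\}_m)$, $h\in G_m$. Walsh functions. For $x\in[0,1)$ with dyadic expansion $x=\frac{\xi_1}2+\frac{\xi_2}{2^2}+\cdots$ (infinitely many digits different from $1$) and $k=\kappa_0+\kappa_12+\cdots+\kappa_{r-1}2^{r-1}\in\mathbb{N}_0$ with $\kappa_j\in\{0,1\}$, $\mathrm{wal}_k(x)=(-1)^{\kappa_0\xi_1+\cdots+\kappa_{r-1}\xi_r}$; $\mathrm{wal}_{\boldsymbol k_{\mathfrak u}}(\boldsymbol y_{\mathfrak u})=\prod_{i\in\mathfrak u}\mathrm{wal}_{k_i}(y_i)$. The function $\mu$. $\mu(0)=0$, $\mu(k)=l$ if $2^{l-1}\le k<2^l$; $\mu(\boldsymbol k_{\mathfrak u})=\sum_{i\in\mathfrak u}\mu(k_i)$. Figure of merit. For points $\mathcal P=\{\boldsymbol y_0,\ldots,\boldsymbol y_{2^m-1}\}$ in $[0,1)^d$ and $\emptyset\ne\mathfrak u\subseteq[d]$, with $\boldsymbol y_{n,\mathfrak u}$ the projection of $\boldsymbol y_n$ to the components in $\mathfrak u$, put $E(\mathcal P,\mathfrak u)=\sum_{\boldsymbol k_{\mathfrak u}\in\{1,\ldots,2^m-1\}^{|\mathfrak u|}}2^{-\mu(\boldsymbol k_{\mathfrak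 u})}\left|\frac1{2^m}\sum_{n=0}^{2^m-1}\mathrm{wal}_{\boldsymbol k_{\mathfrak u}}(\boldsymbol y_{n,\mathfrak u})\right|$. For $\boldsymbol g\in G_m^d$, $B_{\boldsymbol\gamma}(\boldsymbol g,f)=\sum_{\emptyset\ne\mathfrak u\subseteq[d]}\gamma_{\mathfrak u}\prod_{i\in\mathfrak u}(b_i-a_i)\,E(\mathcal P(\boldsymbol g,f),\mathfrak u)$. *)

theory Defs
  imports
    "HOL-Analysis.Analysis"
    "HOL-Library.Z2"
    "HOL-Library.Multiset"
    "HOL-Computational_Algebra.Polynomial"
    "HOL-Computational_Algebra.Formal_Laurent_Series"
begin

text \<open>
  The \<open>i\<close>-th component (\<open>i \<ge> 1\<close>) of a point of \<open>\<real>\<^sup>s\<close> is its value at \<open>i \<in> {1..s}\<close>; points are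
  extensional functions \<open>nat \<Rightarrow> real\<close> on \<open>{1..s}\<close>.
  Point sets are multisets, since points are counted with multiplicity.
\<close>

subsection \<open>Densities, mixed partial derivatives and the norm\<close>

definition prob_density_on :: "real \<Rightarrow> real \<Rightarrow> (real \<Rightarrow> real) \<Rightarrow> bool" where
  "prob_density_on l r p \<longleftrightarrow>
     set_integrable lebesgue {l..r} p \<and> (\<forall>x\<in>{l..r}. 0 \<le> p x) \<and> (LINT x:{l..r}|lebesgue. p x) = 1"

definition distr_fun :: "(nat \<Rightarrow> real) \<Rightarrow> (nat \<Rightarrow> real \<Rightarrow> real) \<Rightarrow> nat \<Rightarrow> real \<Rightarrow> real" where
  "distr_fun a \<phi> i x = (LINT y:{a i..x}|lebesgue. \<phi> i y)"

definition box_on :: "(nat \<Rightarrow> real) \<Rightarrow> (nat \<Rightarrow> real) \<Rightarrow> nat \<Rightarrow> (nat \<Rightarrow> real) set" where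
  "box_on a b s = (\<Pi>\<^sub>E i\<in>{1..s}. {a i..b i})"

definition inv_distr ::
  "(nat \<Rightarrow> real) \<Rightarrow> (nat \<Rightarrow> real) \<Rightarrow> (nat \<Rightarrow> real \<Rightarrow> real) \<Rightarrow> nat \<Rightarrow> (nat \<Rightarrow> real) \<Rightarrow> (nat \<Rightarrow> real)" where
  "inv_distr a b \<phi> s y = (\<lambda>i\<in>{1..s}. the_inv_into {a i..b i} (distr_fun a \<phi> i) (y i))"

text \<open>Derivatives are one-sided at the faces of the box.\<close>

definition partial_deriv ::
  "(nat \<Rightarrow> real) \<Rightarrow> (nat \<Rightarrow> real) \<Rightarrow> nat \<Rightarrow> ((nat \<Rightarrow> real) \<Rightarrow> real) \<Rightarrow> (nat \<Rightarrow> real) \<Rightarrow> real" where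
  "partial_deriv a b i F x = vector_derivative (\<lambda>t. F (x(i := t))) (at (x i) within {a i..b i})"

definition has_partial_deriv ::
  "(nat \<Rightarrow> real) \<Rightarrow> (nat \<Rightarrow> real) \<Rightarrow> nat \<Rightarrow> nat \<Rightarrow> ((nat \<Rightarrow> real) \<Rightarrow> real) \<Rightarrow> bool" where
  "has_partial_deriv a b s i F \<longleftrightarrow>
     (\<forall>x\<in>box_on a b s. (\<lambda>t. F (x(i := t))) differentiable (at (x i) within {a i..b i}))"

text \<open>For a list \<open>[u\<^sub>1, \<dots>, u\<^sub>k]\<close> the derivative with respect to the last variable is taken first,
  as in \<open>\<partial>\<^sup>k F / \<partial>x\<^bsub>u\<^sub>1\<^esub> \<dots> \<partial>x\<^bsub>u\<^sub>k\<^esub>\<close>.\<close>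

fun mixed_partial ::
  "(nat \<Rightarrow> real) \<Rightarrow> (nat \<Rightarrow> real) \<Rightarrow> nat list \<Rightarrow> ((nat \<Rightarrow> real) \<Rightarrow> real) \<Rightarrow> (nat \<Rightarrow> real) \<Rightarrow> real" where
  "mixed_partial a b [] F = F"
| "mixed_partial a b (i # is) F = partial_deriv a b i (mixed_partial a b is F)"

fun has_mixed_partial ::
  "(nat \<Rightarrow> real) \<Rightarrow> (nat \<Rightarrow> real) \<Rightarrow> nat \<Rightarrow> nat list \<Rightarrow> ((nat \<Rightarrow> real) \<Rightarrow> real) \<Rightarrow> bool" where
  "has_mixed_partial a b s [] F \<longleftrightarrow> True"
| "has_mixed_partial a b s (i # is) F \<longleftrightarrow>
     has_mixed_partial a b s is F \<and> has_partial_deriv a b s i (mixed_partial a b is F)"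

text \<open>The norm takes the value \<open>\<infinity>\<close> if one of the derivatives is unbounded.\<close>

definition norm_inf ::
  "(nat \<Rightarrow> real) \<Rightarrow> (nat \<Rightarrow> real) \<Rightarrow> (nat set \<Rightarrow> real) \<Rightarrow> nat \<Rightarrow> ((nat \<Rightarrow> real) \<Rightarrow> real) \<Rightarrow> ereal" where
  "norm_inf a b \<gamma> s F =
     (MAX u\<in>Pow {1..s}. ereal (1 / \<gamma> u) *
        (SUP x\<in>box_on a b s. ereal \<bar>mixed_partial a b (sorted_list_of_set u) F x\<bar>))"

definition unit_ball ::
  "(nat \<Rightarrow> real) \<Rightarrow> (nat \<Rightarrow> real) \<Rightarrow> (nat set \<Rightarrow> real) \<Rightarrow> nat \<Rightarrow> ((nat \<Rightarrow> real) \<Rightarrow> real) set" where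
  "unit_ball a b \<gamma> s =
     {F. (\<forall>u\<subseteq>{1..s}. has_mixed_partial a b s (sorted_list_of_set u) F) \<and> norm_inf a b \<gamma> s F \<le> 1}"

text \<open>Members of the unit ball have bounded first-order partial derivatives, hence are continuous on
  the box, so the integrand below is integrable with respect to the product of the one-dimensional
  Lebesgue measures, which agrees with \<open>s\<close>-dimensional Lebesgue measure up to completion.\<close>

definition wce ::
  "(nat \<Rightarrow> real) multiset \<Rightarrow> (nat \<Rightarrow> real) \<Rightarrow> (nat \<Rightarrow> real) \<Rightarrow> nat \<Rightarrow> (nat set \<Rightarrow> real) \<Rightarrow>
     (nat \<Rightarrow> real \<Rightarrow> real) \<Rightarrow> ereal" where
  "wce P a b s \<gamma> \<phi> =
     (SUP F\<in>unit_ball a b \<gamma> s.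
        ereal \<bar>1 / real (size P) * (\<Sum>y\<in>#P. F (inv_distr a b \<phi> s y))
              - (LINT x:box_on a b s|(\<Pi>\<^sub>M i\<in>{1..s}. lebesgue). F x * (\<Prod>i\<in>{1..s}. \<phi> i (x i)))\<bar>)"


subsection \<open>Polynomial lattice point sets\<close>

text \<open>\<open>\<bbbF>\<^sub>2((x\<^sup>-\<^sup>1))\<close> is \<open>bit fls\<close>, whose indeterminate \<open>fls_X\<close> plays the role of \<open>x\<^sup>-\<^sup>1\<close>: the coefficient of
  \<open>x\<^sup>-\<^sup>k\<close> is \<open>fls_nth L k\<close>, and a polynomial is embedded by evaluating it at \<open>fls_X_inv\<close>.\<close>

definition laurent_of_poly :: "bit poly \<Rightarrow> bit fls" where
  "laurent_of_poly p = poly (map_poly fls_const p) fls_X_inv"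

definition trunc_frac :: "nat \<Rightarrow> bit fls \<Rightarrow> real" where
  "trunc_frac m L = (\<Sum>k=1..m. of_bool (fls_nth L (int k) = 1) / 2 ^ k)"

text \<open>\<open>h = 0\<close> is listed separately because \<open>degree 0 = 0\<close> here.\<close>

definition Gm :: "nat \<Rightarrow> bit poly set" where
  "Gm m = {h. h = 0 \<or> degree h < m}"

lemma finite_Gm: "finite (Gm m)"
proof -
  define L where "L = {xs :: bit list. set xs \<subseteq> {0, 1} \<and> length xs \<le> m}"
  have bits: "x \<in> {0, 1}" for x :: bit
    by (cases x) simp_all
  have "Gm m \<subseteq> Poly ` L"
  proof
    fix h :: "bit poly" assume "h \<in> Gm m"
    then have "length (coeffs h) \<le> m"
      unfolding Gm_def by (cases "h = 0") (simp_all add: length_coeffs_degree)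
    moreover have "set (coeffs h) \<subseteq> {0, 1}"
      by (rule subsetI) (rule bits)
    ultimately show "h \<in> Poly ` L"
      unfolding L_def by (intro image_eqI[where x = "coeffs h"] CollectI conjI Poly_coeffs[symmetric])
  qed
  moreover have "finite L"
    unfolding L_def by (intro finite_lists_length_le finite.insertI finite.emptyI)
  ultimately show ?thesis
    by (rule finite_surj[rotated])
qed

definition poly_lattice :: "nat \<Rightarrow> (nat \<Rightarrow> bit poly) \<Rightarrow> bit poly \<Rightarrow> (nat \<Rightarrow> real) multiset" where
  "poly_lattice d g f =
     image_mset
       (\<lambda>h. \<lambda>i\<in>{1..d}. trunc_frac (degree f) (laurent_of_poly (h * g i) / laurent_of_poly f))
       (mset_set (Gm (degree f)))"


subsection \<open>Walsh functions and the figure of merit\<close>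

definition mu :: "nat \<Rightarrow> nat" where
  "mu k = (if k = 0 then 0 else (THE l. 2 ^ (l - 1) \<le> k \<and> k < 2 ^ l))"

text \<open>For \<open>x \<in> [0,1)\<close> this is the \<open>j\<close>-th digit (\<open>j \<ge> 1\<close>) of the dyadic expansion of \<open>x\<close> that has
  infinitely many digits different from \<open>1\<close>.\<close>

definition dyadic_digit :: "real \<Rightarrow> nat \<Rightarrow> nat" where
  "dyadic_digit x j = nat (\<lfloor>2 ^ j * x\<rfloor> mod 2)"

text \<open>The binary digits of \<open>k\<close> at positions \<open>j \<ge> mu k\<close> vanish.\<close>

definition wal :: "nat \<Rightarrow> real \<Rightarrow> real" where
  "wal k x = (- 1) ^ (\<Sum>j<mu k. (k div 2 ^ j mod 2) * dyadic_digit x (j + 1))"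

definition merit_E :: "nat \<Rightarrow> (nat \<Rightarrow> real) multiset \<Rightarrow> nat set \<Rightarrow> real" where
  "merit_E m P u =
     (\<Sum>k\<in>(\<Pi>\<^sub>E i\<in>u. {1..2 ^ m - 1}).
        1 / 2 ^ (\<Sum>i\<in>u. mu (k i)) * \<bar>1 / 2 ^ m * (\<Sum>y\<in>#P. \<Prod>i\<in>u. wal (k i) (y i))\<bar>)"

definition merit_B ::
  "(nat \<Rightarrow> real) \<Rightarrow> (nat \<Rightarrow> real) \<Rightarrow> (nat set \<Rightarrow> real) \<Rightarrow> nat \<Rightarrow> (nat \<Rightarrow> bit poly) \<Rightarrow> bit poly \<Rightarrow> real" where
  "merit_B a b \<gamma> d g f =
     (\<Sum>u\<in>Pow {1..d} - {{}}.
        \<gamma> u * (\<Prod>i\<in>u. b i - a i) * merit_E (degree f) (poly_lattice d g f) u)"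

definition cbc_constructed ::
  "(nat \<Rightarrow> real) \<Rightarrow> (nat \<Rightarrow> real) \<Rightarrow> (nat set \<Rightarrow> real) \<Rightarrow> nat \<Rightarrow> (nat \<Rightarrow> bit poly) \<Rightarrow> bit poly \<Rightarrow> bool" where
  "cbc_constructed a b \<gamma> s g f \<longleftrightarrow>
     g 1 = 1 \<and>
     (\<forall>d\<in>{2..s}. is_arg_min (\<lambda>q. merit_B a b \<gamma> d (g(d := q)) f) (\<lambda>q. q \<in> Gm (degree f)) (g d))"


subsection \<open>Constants in the error bounds\<close>

definition C_Poly :: "(nat \<Rightarrow> real) \<Rightarrow> (nat \<Rightarrow> real) \<Rightarrow> real \<Rightarrow> (nat set \<Rightarrow> real) \<Rightarrow> ereal" where
  "C_Poly a b \<delta> \<gamma> =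
     (SUP s\<in>{1..}. ereal (\<Sum>u\<in>Pow {1..s} - {{}}.
        \<gamma> u * (\<Prod>i\<in>u. max 2 (real (card u) / (exp 1 * \<delta> * 2 * ln 2)) * (b i - a i))))"

text \<open>Terms of the series \<open>S(\<gamma>)\<close>, for \<open>i \<ge> 1\<close>; the value of the weight at \<open>{}\<close> is replaced by \<open>1\<close>.\<close>

definition S_term :: "(nat \<Rightarrow> real) \<Rightarrow> (nat \<Rightarrow> real) \<Rightarrow> (nat set \<Rightarrow> real) \<Rightarrow> nat \<Rightarrow> real" where
  "S_term a b \<gamma> i = (b i - a i) * (MAX v\<in>Pow {1..i - 1}. \<gamma> (v \<union> {i}) / (\<gamma>({} := 1)) v)"

definition S_sum :: "(nat \<Rightarrow> real) \<Rightarrow> (nat \<Rightarrow> real) \<Rightarrow> (nat set \<Rightarrow> real) \<Rightarrow> real" where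
  "S_sum a b \<gamma> = (\<Sum>i. S_term a b \<gamma> (i + 1))"

definition C_Poly_prod ::
  "(nat \<Rightarrow> real) \<Rightarrow> (nat \<Rightarrow> real) \<Rightarrow> real \<Rightarrow> (nat set \<Rightarrow> real) \<Rightarrow> nat \<Rightarrow> real" where
  "C_Poly_prod a b \<delta> \<gamma> n = (5 * S_sum a b \<gamma> / (\<delta> * ln 2)) ^ n"

end

theory Submission
  imports Defs "HOL-Computational_Algebra.Polynomial_Factorial"
begin

text \<open>
  Put \<open>N = 2\<^sup>m\<close> and sample \<open>F\<close> at the quantiles \<open>z\<^sub>i(j) = \<Phi>\<^sub>i\<^sup>-\<^sup>1(j/N)\<close>; all lattice points lie on this grid.
  The sampled function is a finite Walsh series. Summation by parts against the partial sums of
  \<open>wal\<^sub>k\<close>, which are at most \<open>N 2\<^sup>-\<^sup>\<mu>\<^sup>(\<^sup>k\<^sup>)\<close>, and the mean value theorem bound the coefficient with support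
  \<open>u\<close> by \<open>\<gamma>\<^sub>u \<Prod>\<^sub>u (b\<^sub>i - a\<^sub>i) 2\<^sup>-\<^sup>\<mu>\<^sup>(\<^sup>k\<^sup>)\<close>, so that the nonconstant part of the series contributes at most
  \<open>B\<^sub>\<gamma>(g, f)\<close>. The constant coefficient is a Riemann sum of the integral with error at most
  \<open>\<Sum>\<^sub>i \<gamma>\<^sub>i (b\<^sub>i - a\<^sub>i) / N\<close>.

  On a polynomial lattice the Walsh means are indicators of the dual net. Averaging over the last
  component and using irreducibility of \<open>f\<close>, the component-by-component construction gives
  \<open>N B\<^sub>\<gamma>(g, f) \<le> \<Sum>\<^sub>u \<gamma>\<^sub>u \<Prod>\<^sub>u (b\<^sub>i - a\<^sub>i) (m/2)\<^sup>|\<^sup>u\<^sup>|\<close>. Part (i) maximises \<open>x\<^sup>k 2\<^sup>-\<^sup>2\<^sup>\<delta>\<^sup>x\<close> over \<open>x = m/2\<close>. In part (ii) the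
  weights are dominated by product weights and the resulting product is split after \<open>n\<close> factors.
\<close>

subsection \<open>Walsh functions on polynomial lattice points\<close>

text \<open>The unit ball dictates the method. Its members have mixed partials that exist in one
  fixed order and are bounded; neither their continuity nor the interchange of derivatives is given,
  so there is no integral representation to work with. Hence Walsh coefficients are taken as finite
  sums over a grid, where summation by parts and the mean value inequality suffice, and the
  variables are treated in the order in which the derivatives are taken.

  The grid consists of quantiles because its cells then all have mass 1/N under the density: the
  equal-weight grid average is a Riemann sum of the weighted integral, whatever the density looks
  like.

  The price is the linear Riemann error. In part (i) it takes one of the two copies of the constant.
  In part (ii) it is absorbed into the product over the coordinates by replacing m/2 with 1 + m/2.
  As m >= 1, this is at most 5m/2, and with D = \<delta> ln 2 / 5 the factor exp (2 D (1 + m/2)) is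
  at most 2^(m \<delta>).\<close>

lemma mu_bounds:
  assumes "k \<ge> 1"
  shows "1 \<le> mu k" "2 ^ (mu k - 1) \<le> k" "k < 2 ^ mu k"
proof -
  define l where "l = (LEAST l. k < 2 ^ l)"
  have ex: "k < 2 ^ k" by (rule less_exp)
  have l: "k < 2 ^ l" unfolding l_def by (rule LeastI[of _ k], rule ex)
  have "l \<ge> 1" using l assms by (cases l) auto
  then have "\<not> k < 2 ^ (l - 1)" using not_less_Least[of "l - 1" "\<lambda>l. k < 2 ^ l"] by (simp add: l_def)
  then have l': "2 ^ (l - 1) \<le> k" by simp
  have uni: "l' = l" if "2 ^ (l' - 1) \<le> k \<and> k < 2 ^ l'" for l'
  proof (rule antisym)
    have "(2::nat) ^ (l' - 1) < 2 ^ l" using that l by linarith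
    then have "l' - 1 < l" by simp
    then show "l' \<le> l" by simp
    have "(2::nat) ^ (l - 1) < 2 ^ l'" using that l' by linarith
    then have "l - 1 < l'" by simp
    then show "l \<le> l'" by simp
  qed
  have "(THE l. 2 ^ (l - 1) \<le> k \<and> k < 2 ^ l) = l"
  proof (rule the_equality)
    show "2 ^ (l - 1) \<le> k \<and> k < 2 ^ l" using l l' by simp
  qed (rule uni)
  then have "mu k = l" using assms by (simp add: mu_def)
  then show "1 \<le> mu k" "2 ^ (mu k - 1) \<le> k" "k < 2 ^ mu k" using l l' \<open>l \<ge> 1\<close> by auto
qed

lemma mu_0 [simp]: "mu 0 = 0"
  by (simp add: mu_def)

lemma mu_le:
  assumes "k < 2 ^ m"
  shows "mu k \<le> m"
proof (cases "k = 0")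
  case False
  then have "2 ^ (mu k - 1) \<le> k" "1 \<le> mu k" using mu_bounds[of k] by auto
  then have "(2::nat) ^ (mu k - 1) < 2 ^ m" using assms by linarith
  then have "mu k - 1 < m" by simp
  with \<open>1 \<le> mu k\<close> show ?thesis by linarith
qed simp

lemma mu_eqI:
  assumes "2 ^ l \<le> k" "k < 2 ^ Suc l"
  shows "mu k = Suc l"
proof -
  have "k \<ge> 1" using assms(1) by (metis one_le_numeral one_le_power order_trans)
  note b = mu_bounds[OF this]
  have "(2::nat) ^ (mu k - 1) < 2 ^ Suc l" using b assms by linarith
  then have "mu k - 1 < Suc l" by (rule power_less_imp_less_exp[rotated]) simp
  moreover have "(2::nat) ^ l < 2 ^ mu k" using b assms by linarith
  then have "l < mu k" by (rule power_less_imp_less_exp[rotated]) simp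
  ultimately show ?thesis by linarith
qed

section \<open>Finite binary expansions and their digits\<close>

definition binary_fraction :: "(nat \<Rightarrow> bool) \<Rightarrow> nat \<Rightarrow> real" where
  "binary_fraction c m = (\<Sum>k<m. of_bool (c k) / 2 ^ Suc k)"

text \<open>Indexing the digits from 0 makes removal of the leading digit a shift of
  \<open>c\<close>; this halving recursion drives the inductions on finite expansions.\<close>

lemma binary_fraction_Suc:
  "binary_fraction c (Suc m) = (of_bool (c 0) + binary_fraction (\<lambda>k. c (Suc k)) m) / 2"
  unfolding binary_fraction_def
  by (simp add: sum.lessThan_Suc_shift sum_divide_distrib add_divide_distrib mult.commute del: sum.lessThan_Suc)

lemma binary_fraction_grid:
  "\<exists>p<2 ^ m. binary_fraction c m = real p / 2 ^ m"
proof (induction m arbitrary: c)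
  case 0
  then show ?case by (simp add: binary_fraction_def)
next
  case (Suc m)
  obtain p where p: "p < 2 ^ m" "binary_fraction (\<lambda>k. c (Suc k)) m = real p / 2 ^ m"
    using Suc by blast
  show ?case
    by (rule exI[of _ "of_bool (c 0) * 2 ^ m + p"])
       (use p in \<open>auto simp: binary_fraction_Suc field_simps\<close>)
qed

lemma binary_fraction_range: "0 \<le> binary_fraction c m" "binary_fraction c m < 1"
proof -
  obtain p where p: "p < 2 ^ m" "binary_fraction c m = real p / 2 ^ m"
    using binary_fraction_grid by blast
  have "real p < 2 ^ m" using p(1) by (metis of_nat_less_iff of_nat_numeral of_nat_power)
  then show "0 \<le> binary_fraction c m" "binary_fraction c m < 1" using p by auto
qed

text \<open>A finite expansion continues with zeros, so it is the one with infinitely many digits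
  different from 1, and the floor in \<open>dyadic_digit\<close> reads it without carry because the
  remaining fraction stays below 1.\<close>

lemma digit_binary_fraction:
  assumes "j < m"
  shows "dyadic_digit (binary_fraction c m) (Suc j) = of_bool (c j)"
  using assms
proof (induction m arbitrary: c j)
  case (Suc m)
  let ?x = "binary_fraction (\<lambda>k. c (Suc k)) m"
  have x: "0 \<le> ?x" "?x < 1" by (rule binary_fraction_range)+
  show ?case
  proof (cases j)
    case 0
    have "\<lfloor>of_bool (c 0) + ?x\<rfloor> = of_bool (c 0)"
      using x by (intro floor_unique) auto
    moreover have "2 ^ Suc j * binary_fraction c (Suc m) = of_bool (c 0) + ?x"
      using 0 by (simp add: binary_fraction_Suc)
    ultimately show ?thesis using 0 by (simp only: dyadic_digit_def) (simp add: of_bool_def)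
  next
    case (Suc j')
    \<comment> \<open>Beyond the first position the leading digit contributes an even integer, which
      the reduction modulo 2 discards.\<close>
    have "2 ^ Suc j * binary_fraction c (Suc m) = of_int (2 * (2 ^ j' * of_bool (c 0))) + 2 ^ Suc j' * ?x"
      using Suc by (simp add: binary_fraction_Suc field_simps)
    then have "\<lfloor>2 ^ Suc j * binary_fraction c (Suc m)\<rfloor> = 2 * (2 ^ j' * of_bool (c 0)) + \<lfloor>2 ^ Suc j' * ?x\<rfloor>"
      by (metis floor_add_int add.commute)
    then have "dyadic_digit (binary_fraction c (Suc m)) (Suc j) = dyadic_digit ?x (Suc j')"
      by (simp add: dyadic_digit_def)
    then show ?thesis using Suc.IH[of j' "\<lambda>k. c (Suc k)"] Suc.prems Suc by simp
  qed
qed simp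

lemma trunc_frac_eq: "trunc_frac m L = binary_fraction (\<lambda>k. fls_nth L (int k + 1) = 1) m"
  unfolding trunc_frac_def binary_fraction_def
  by (rule sum.reindex_bij_witness[of _ Suc "\<lambda>k. k - 1"]) (auto simp: of_nat_diff algebra_simps)

text \<open>The nontrivial additive character of F_2; through it, Walsh means over a lattice become
  character sums.\<close>

definition chi :: "bit \<Rightarrow> real" where
  "chi c = (if c = 1 then - 1 else 1)"

lemma chi_add: "chi (c + d) = chi c * chi d"
  by (cases c; cases d) (auto simp: chi_def)

lemma chi_0 [simp]: "chi 0 = 1" and chi_1 [simp]: "chi 1 = - 1"
  by (simp_all add: chi_def)

lemma chi_sum: "chi (\<Sum>i\<in>A. c i) = (\<Prod>i\<in>A. chi (c i))"
  by (induction A rule: infinite_finite_induct) (simp_all only: sum.infinite sum.empty sum.insert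
    prod.infinite prod.empty prod.insert chi_add chi_0 simp_thms)

text \<open>Since \<open>mu k \<le> m\<close>, truncation after \<open>m\<close> digits removes none
  that \<open>wal k\<close> reads, and the digits that remain are Laurent coefficients.\<close>

lemma wal_trunc_frac:
  assumes "k < 2 ^ m"
  shows "wal k (trunc_frac m L) = chi (\<Sum>j<mu k. of_nat (k div 2 ^ j mod 2) * fls_nth L (int j + 1))"
proof -
  have "wal k (trunc_frac m L) =
      (\<Prod>j<mu k. (- 1) ^ ((k div 2 ^ j mod 2) * dyadic_digit (trunc_frac m L) (j + 1)))"
    unfolding wal_def by (simp add: power_sum)
  also have "\<dots> = (\<Prod>j<mu k. chi (of_nat (k div 2 ^ j mod 2) * fls_nth L (int j + 1)))"
  proof (rule prod.cong[OF refl])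
    fix j assume "j \<in> {..<mu k}"
    then have "j < m" using mu_le[OF assms] by simp
    then have "dyadic_digit (trunc_frac m L) (j + 1) = of_bool (fls_nth L (int j + 1) = 1)"
      by (simp add: trunc_frac_eq digit_binary_fraction)
    moreover have "k div 2 ^ j mod 2 = 0 \<or> k div 2 ^ j mod 2 = 1" by linarith
    ultimately show "(- 1) ^ ((k div 2 ^ j mod 2) * dyadic_digit (trunc_frac m L) (j + 1)) =
        chi (of_nat (k div 2 ^ j mod 2) * fls_nth L (int j + 1))"
      by (auto simp: chi_def)
  qed
  finally show ?thesis by (simp only: chi_sum)
qed

section \<open>Polynomials as Laurent series and the residue functional\<close>

lemma map_poly_fls_const_pCons:
  "map_poly fls_const (pCons c p) = pCons (fls_const c) (map_poly fls_const p)"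
  by (rule map_poly_pCons) simp

lemma laurent_of_poly_0 [simp]: "laurent_of_poly 0 = 0"
  by (simp add: laurent_of_poly_def)

lemma laurent_of_poly_pCons:
  "laurent_of_poly (pCons c p) = fls_const c + fls_X_inv * laurent_of_poly p"
  by (simp add: laurent_of_poly_def map_poly_fls_const_pCons)

lemma laurent_of_poly_add: "laurent_of_poly (p + q) = laurent_of_poly p + laurent_of_poly q"
proof (induction p arbitrary: q)
  case (pCons c p)
  then show ?case
    by (cases q) (simp add: laurent_of_poly_pCons algebra_simps fls_plus_const)
qed simp

lemma laurent_of_poly_smult: "laurent_of_poly (smult c p) = fls_const c * laurent_of_poly p"
  by (induction p) (simp_all add: laurent_of_poly_pCons algebra_simps fls_const_mult_const)

lemma laurent_of_poly_mult: "laurent_of_poly (p * q) = laurent_of_poly p * laurent_of_poly q"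
  by (induction p)
     (simp_all add: laurent_of_poly_add laurent_of_poly_smult laurent_of_poly_pCons algebra_simps)

lemma laurent_of_poly_nth:
  "fls_nth (laurent_of_poly p) i = (if i \<le> 0 then coeff p (nat (- i)) else 0)"
proof (induction p arbitrary: i)
  case (pCons c p)
  have *: "fls_nth (laurent_of_poly (pCons c p)) i =
      (if i = 0 then c else 0) + (if i + 1 \<le> 0 then coeff p (nat (- (i + 1))) else 0)"
    unfolding laurent_of_poly_pCons fls_plus_nth fls_const_nth
      fls_X_inv_times_conv_shift fls_shift_nth pCons.IH ..
  show ?case
  proof (cases "i < 0")
    case True
    then have "nat (- i) = Suc (nat (- (i + 1)))" by simp
    then show ?thesis using True unfolding * by simp
  qed (unfold *, auto)
qed simp

lemma laurent_of_poly_eq_0_iff [simp]: "laurent_of_poly p = 0 \<longleftrightarrow> p = 0"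
proof
  assume "laurent_of_poly p = 0"
  then have "coeff p n = 0" for n using laurent_of_poly_nth[of p "- int n"] by simp
  then show "p = 0" by (simp add: poly_eq_iff)
qed simp

lemma fls_subdegree_laurent_of_poly: "fls_subdegree (laurent_of_poly p) = - int (degree p)"
proof (cases "p = 0")
  case False
  then show ?thesis
    by (intro fls_subdegree_eqI) (auto simp: laurent_of_poly_nth intro!: coeff_eq_0)
qed simp

lemma laurent_of_poly_monom_mult:
  "laurent_of_poly (monom 1 j * p) = fls_shift (int j) (laurent_of_poly p)"
proof -
  have "laurent_of_poly (monom 1 j) = fls_X_inv ^ j"
  proof (rule fls_eqI)
    fix n :: int
    show "fls_nth (laurent_of_poly (monom 1 j)) n = fls_nth (fls_X_inv ^ j) n"
      unfolding laurent_of_poly_nth fls_X_inv_power_nth coeff_monom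
      using nat_eq_iff[of "- n" j] by (auto; linarith)
  qed
  then show ?thesis
    by (simp add: laurent_of_poly_mult fls_X_inv_power_times_conv_shift)
qed

text \<open>An additive functional on F_2[x] that vanishes on the multiples of \<open>f\<close> and
  so lives on F_2[x]/(f). This one coefficient suffices, because multiplication by a power of x
  moves any later digit into its position.\<close>

definition residue_frac :: "bit poly \<Rightarrow> bit poly \<Rightarrow> bit" where
  "residue_frac f p = fls_nth (laurent_of_poly p / laurent_of_poly f) 1"

lemma residue_frac_add: "residue_frac f (p + q) = residue_frac f p + residue_frac f q"
  by (simp add: residue_frac_def laurent_of_poly_add add_divide_distrib)

lemma residue_frac_0 [simp]: "residue_frac f 0 = 0"
  by (simp add: residue_frac_def)

lemma residue_frac_sum: "residue_frac f (\<Sum>i\<in>A. p i) = (\<Sum>i\<in>A. residue_frac f (p i))"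
  by (induction A rule: infinite_finite_induct) (simp_all add: residue_frac_add)

lemma residue_frac_mult_self: "residue_frac f (f * p) = 0"
  by (cases "f = 0") (simp_all add: residue_frac_def laurent_of_poly_mult laurent_of_poly_nth)

lemma residue_frac_monom_mult:
  "residue_frac f (monom 1 j * p) = fls_nth (laurent_of_poly p / laurent_of_poly f) (int j + 1)"
proof -
  have "laurent_of_poly (monom 1 j * p) / laurent_of_poly f = fls_X_inv ^ j * (laurent_of_poly p / laurent_of_poly f)"
    by (simp only: laurent_of_poly_monom_mult fls_X_inv_power_times_conv_shift(1)[symmetric] times_divide_eq_right)
  then show ?thesis
    unfolding residue_frac_def by (simp only: fls_X_inv_power_times_conv_shift fls_shift_nth add.commute)
qed

text \<open>The quotient has leading order 1/x, and a nonzero coefficient in F_2 is 1. This shows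
  that the functional is not identically zero.\<close>

lemma residue_frac_top:
  assumes "degree f = Suc n"
  shows "residue_frac f (monom 1 n) = 1"
proof -
  let ?q = "laurent_of_poly (monom 1 n) / laurent_of_poly f"
  have "f \<noteq> 0" using assms by auto
  then have "?q \<noteq> 0" by (simp add: monom_eq_0_iff)
  moreover have "fls_subdegree ?q = 1"
    using \<open>f \<noteq> 0\<close> assms
    by (subst fls_divide_subdegree) (auto simp: fls_subdegree_laurent_of_poly degree_monom_eq monom_eq_0_iff)
  ultimately have "fls_nth ?q 1 \<noteq> 0" using nth_fls_subdegree_nonzero[of ?q] by simp
  then show ?thesis by (simp add: residue_frac_def)
qed

definition nat_poly :: "nat \<Rightarrow> bit poly" where
  "nat_poly k = (\<Sum>j<mu k. monom (of_nat (k div 2 ^ j mod 2)) j)"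

lemma coeff_nat_poly: "coeff (nat_poly k) j = (if j < mu k then of_nat (k div 2 ^ j mod 2) else 0)"
  by (simp add: nat_poly_def coeff_sum)

lemma nat_poly_neq_0:
  assumes "k \<ge> 1"
  shows "nat_poly k \<noteq> 0"
proof -
  note b = mu_bounds[OF assms]
  have "k div 2 ^ (mu k - 1) < 2"
    using b power_minus_mult[of "mu k" "2::nat"] by (intro less_mult_imp_div_less) (simp add: mult.commute)
  moreover have "k div 2 ^ (mu k - 1) > 0" using b by (simp add: div_greater_zero_iff)
  ultimately have "k div 2 ^ (mu k - 1) = 1" by linarith
  then have "coeff (nat_poly k) (mu k - 1) = 1" using b by (simp add: coeff_nat_poly)
  then show ?thesis by auto
qed

lemma nat_poly_Gm:
  assumes "k < 2 ^ m"
  shows "nat_poly k \<in> Gm m"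
proof (cases "nat_poly k = 0")
  case False
  have "\<not> m \<le> degree (nat_poly k)"
  proof
    assume "m \<le> degree (nat_poly k)"
    then have "coeff (nat_poly k) (degree (nat_poly k)) = 0"
      using mu_le[OF assms] by (simp add: coeff_nat_poly)
    then show False using False by simp
  qed
  then show ?thesis by (simp add: Gm_def)
qed (simp add: Gm_def)

text \<open>Digit \<open>j\<close> of \<open>k\<close> is paired with the coefficient of x^(-j-1),
  which is the residue after multiplication by x^j. Additivity collects all digits into one
  multiplication by \<open>nat_poly k\<close>.\<close>

lemma wal_lattice:
  assumes "k < 2 ^ m"
  shows "wal k (trunc_frac m (laurent_of_poly p / laurent_of_poly f)) = chi (residue_frac f (nat_poly k * p))"
proof -
  have "residue_frac f (nat_poly k * p) =
      (\<Sum>j<mu k. residue_frac f (monom (of_nat (k div 2 ^ j mod 2)) j * p))"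
    by (simp add: nat_poly_def sum_distrib_right residue_frac_sum)
  also have "\<dots> = (\<Sum>j<mu k. of_nat (k div 2 ^ j mod 2) *
      fls_nth (laurent_of_poly p / laurent_of_poly f) (int j + 1))"
  proof (rule sum.cong[OF refl])
    fix j
    have "k div 2 ^ j mod 2 = 0 \<or> k div 2 ^ j mod 2 = 1" by linarith
    then show "residue_frac f (monom (of_nat (k div 2 ^ j mod 2)) j * p) =
        of_nat (k div 2 ^ j mod 2) * fls_nth (laurent_of_poly p / laurent_of_poly f) (int j + 1)"
      by (auto simp: residue_frac_monom_mult)
  qed
  finally show ?thesis by (simp add: wal_trunc_frac[OF assms])
qed

section \<open>Residues modulo an irreducible polynomial\<close>

lemma Gm_0: "Gm 0 = {0}"
  by (auto simp: Gm_def)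

lemma Gm_Suc: "Gm (Suc m) = (\<lambda>(c, p). pCons c p) ` (UNIV \<times> Gm m)"
proof (intro equalityI subsetI)
  fix p assume p: "p \<in> Gm (Suc m)"
  obtain c q where pq: "p = pCons c q" by (cases p)
  have "q \<in> Gm m" using p by (auto simp: pq Gm_def split: if_splits)
  then show "p \<in> (\<lambda>(c, p). pCons c p) ` (UNIV \<times> Gm m)" using pq by auto
next
  fix p assume "p \<in> (\<lambda>(c, p). pCons c p) ` (UNIV \<times> Gm m)"
  then show "p \<in> Gm (Suc m)" by (auto simp: Gm_def degree_pCons_eq_if split: if_splits)
qed

lemma card_Gm: "card (Gm m) = 2 ^ m"
proof (induction m)
  case (Suc m)
  have "inj_on (\<lambda>(c, p). pCons c p) (UNIV \<times> Gm m)" by (auto simp: inj_on_def)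
  moreover have "(UNIV :: bit set) = {0, 1}"
    by (auto intro: bit.exhaust)
  then have "card (UNIV :: bit set) = card {0, 1 :: bit}" by (rule arg_cong)
  then have "card (UNIV :: bit set) = 2" by simp
  ultimately show ?case using Suc by (simp add: Gm_Suc card_image card_cartesian_product)
qed (simp add: Gm_0)

lemma Gm_add: "p \<in> Gm m \<Longrightarrow> q \<in> Gm m \<Longrightarrow> p + q \<in> Gm m"
  by (auto simp: Gm_def intro: degree_add_less)

lemma Gm_diff: "p \<in> Gm m \<Longrightarrow> q \<in> Gm m \<Longrightarrow> p - q \<in> Gm m"
  by (auto simp: Gm_def intro: degree_diff_less)

lemma Gm_dvd_imp_0: "p \<in> Gm (degree f) \<Longrightarrow> f dvd p \<Longrightarrow> p = 0"
  by (auto simp: Gm_def dest: dvd_imp_degree_le)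

lemma prime_elem_if_irreducible: "irreducible f \<Longrightarrow> prime_elem f" for f :: "bit poly"
  by (rule field_poly_irreducible_imp_prime)

lemma degree_irreducible_pos: "irreducible f \<Longrightarrow> degree f > 0" for f :: "bit poly"
  by (metis gr0I irreducible_def is_unit_iff_degree)

text \<open>Multiplication by \<open>q\<close> is injective on the residues because \<open>f\<close>
  is prime, hence surjective on the finite set \<open>Gm (degree f)\<close>; so it reaches the top
  monomial, whose residue is 1.\<close>

lemma exists_residue_1:
  assumes "irreducible f" "\<not> f dvd q"
  shows "\<exists>h\<in>Gm (degree f). residue_frac f (h * q) = 1"
proof -
  note pr = prime_elem_if_irreducible[OF assms(1)]
  have f0: "f \<noteq> 0" using assms by auto
  have sub: "(\<lambda>h. (h * q) mod f) ` Gm (degree f) \<subseteq> Gm (degree f)"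
    using degree_mod_less[OF f0] by (auto simp: Gm_def)
  have "inj_on (\<lambda>h. (h * q) mod f) (Gm (degree f))"
  proof (rule inj_onI)
    fix h h' assume h: "h \<in> Gm (degree f)" "h' \<in> Gm (degree f)" "(h * q) mod f = (h' * q) mod f"
    then have "f dvd (h - h') * q" by (simp add: mod_eq_dvd_iff left_diff_distrib)
    then have "f dvd h - h'" using prime_elem_dvd_multD[OF pr] assms(2) by blast
    then have "h - h' = 0" using Gm_dvd_imp_0[OF Gm_diff[OF h(1,2)]] by blast
    then show "h = h'" by (simp only: right_minus_eq)
  qed
  then have "(\<lambda>h. (h * q) mod f) ` Gm (degree f) = Gm (degree f)"
    by (rule endo_inj_surj[OF finite_Gm sub])
  moreover obtain n where n: "degree f = Suc n"
    using degree_irreducible_pos[OF assms(1)] by (metis gr0_implies_Suc)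
  moreover have "monom 1 n \<in> Gm (degree f)" by (simp add: Gm_def n degree_monom_eq)
  ultimately have "monom 1 n \<in> (\<lambda>h. (h * q) mod f) ` Gm (degree f)" by (simp only:)
  then obtain h where h: "monom 1 n = (h * q) mod f" "h \<in> Gm (degree f)" by (rule imageE)
  have "residue_frac f (h * q) = residue_frac f (f * (h * q div f) + (h * q) mod f)"
    by (simp only: mult_div_mod_eq)
  also have "\<dots> = 1"
    unfolding residue_frac_add residue_frac_mult_self h(1)[symmetric] residue_frac_top[OF n] by simp
  finally show ?thesis using h by blast
qed

text \<open>Translation by an \<open>h0\<close> of residue 1 permutes the summands and flips every
  sign, so the sum equals its own negative.\<close>

lemma sum_chi_residue:
  assumes "irreducible f" "\<not> f dvd q"
  shows "(\<Sum>h\<in>Gm (degree f). chi (residue_frac f (h * q))) = 0"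
proof -
  obtain h0 where h0: "h0 \<in> Gm (degree f)" "residue_frac f (h0 * q) = 1"
    using exists_residue_1[OF assms] by blast
  let ?S = "\<Sum>h\<in>Gm (degree f). chi (residue_frac f (h * q))"
  have "?S = (\<Sum>h\<in>Gm (degree f). chi (residue_frac f ((h + h0) * q)))"
    by (rule sum.reindex_bij_witness[of _ "\<lambda>h. h + h0" "\<lambda>h. h - h0"]) (auto intro: Gm_add Gm_diff h0)
  also have "\<dots> = - ?S"
    by (simp only: distrib_right residue_frac_add chi_add h0 chi_1 mult_minus_right mult_1_right sum_negf)
  finally show ?thesis by simp
qed

subsection \<open>The component-by-component construction\<close>

lemma sum_two_power_split:
  fixes t :: "nat \<Rightarrow> 'a::comm_monoid_add"
  shows "(\<Sum>k<2 ^ Suc m. t k) = (\<Sum>k<2 ^ m. t k) + (\<Sum>k<2 ^ m. t (2 ^ m + k))"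
proof -
  have "{..<2 ^ Suc m} = {..<2 ^ m} \<union> {2 ^ m..<2 ^ Suc m :: nat}" by auto
  then have "(\<Sum>k<2 ^ Suc m. t k) = (\<Sum>k<2 ^ m. t k) + (\<Sum>k=2 ^ m..<2 ^ Suc m. t k)"
    by (simp add: sum.union_disjoint ivl_disj_int)
  also have "(\<Sum>k=2 ^ m..<2 ^ Suc m. t k) = (\<Sum>k<2 ^ m. t (2 ^ m + k))"
    by (rule sum.reindex_bij_witness[of _ "\<lambda>k. 2 ^ m + k" "\<lambda>k. k - 2 ^ m"]) auto
  finally show ?thesis .
qed

text \<open>Each dyadic block 2^l <= k < 2^(l+1) consists of 2^l terms of size 2^(-l-1) and
  contributes 1/2. This is the origin of m/2 in the bounds.\<close>

lemma sum_inverse_power_mu: "(\<Sum>k=1..2 ^ m - 1. 1 / 2 ^ mu k) = real m / 2"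
proof (induction m)
  case (Suc m)
  have *: "{1..2 ^ n - 1} = {..<2 ^ n} - {0::nat}" for n by auto
  have **: "(\<Sum>k=1..2 ^ n - 1. 1 / 2 ^ mu k) = (\<Sum>k<2 ^ n. 1 / 2 ^ mu k) - (1::real)" for n
    unfolding * by (subst sum_diff1) auto
  have "(\<Sum>k<2 ^ m. 1 / 2 ^ mu (2 ^ m + k)) = (\<Sum>k<(2::nat) ^ m. 1 / 2 ^ Suc m :: real)"
    by (intro sum.cong refl) (simp add: mu_eqI[of m])
  also have "\<dots> = 1 / 2" by simp
  finally show ?case using Suc unfolding ** sum_two_power_split by simp
qed simp

text \<open>For a fixed wave vector the product of characters is a single character of
  \<open>h\<close> times one polynomial. Its sum over \<open>h\<close> is 2^m or 0 according to
  divisibility by \<open>f\<close>, so the figure of merit becomes a sum over the dual net.\<close>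

lemma merit_E_lattice:
  assumes "irreducible f" "u \<subseteq> {1..d}"
  shows "merit_E (degree f) (poly_lattice d g f) u =
    (\<Sum>k\<in>(\<Pi>\<^sub>E i\<in>u. {1..2 ^ degree f - 1}).
      (\<Prod>i\<in>u. 1 / 2 ^ mu (k i)) * of_bool (f dvd (\<Sum>i\<in>u. nat_poly (k i) * g i)))"
  unfolding merit_E_def
proof (rule sum.cong[OF refl])
  fix k assume k: "k \<in> (\<Pi>\<^sub>E i\<in>u. {1..2 ^ degree f - 1 :: nat})"
  let ?m = "degree f" and ?q = "\<Sum>i\<in>u. nat_poly (k i) * g i"
  have "finite u" using assms(2) by (rule finite_subset) simp
  have less: "k i < 2 ^ ?m" if "i \<in> u" for i
  proof -
    have "k i \<le> 2 ^ ?m - 1" using k that by (auto dest: PiE_mem)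
    moreover have "(0::nat) < 2 ^ ?m" by simp
    ultimately show ?thesis by linarith
  qed
  have "(\<Sum>y\<in>#poly_lattice d g f. \<Prod>i\<in>u. wal (k i) (y i)) =
      (\<Sum>h\<in>Gm ?m. \<Prod>i\<in>u. wal (k i) ((\<lambda>i\<in>{1..d}. trunc_frac ?m (laurent_of_poly (h * g i) / laurent_of_poly f)) i))"
    by (simp add: poly_lattice_def sum_unfold_sum_mset multiset.map_comp o_def)
  also have "\<dots> = (\<Sum>h\<in>Gm ?m. \<Prod>i\<in>u. chi (residue_frac f (nat_poly (k i) * (h * g i))))"
    using assms(2) by (intro sum.cong prod.cong refl) (auto simp: wal_lattice[OF less])
  also have "\<dots> = (\<Sum>h\<in>Gm ?m. chi (residue_frac f (h * ?q)))"
    by (simp only: chi_sum[symmetric] residue_frac_sum[symmetric] sum_distrib_left mult.left_commute mult.commute)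
  also have "\<dots> = 2 ^ ?m * of_bool (f dvd ?q)"
  proof (cases "f dvd ?q")
    case True
    then have "f dvd h * ?q" for h by (rule dvd_mult)
    then have "residue_frac f (h * ?q) = 0" for h by (metis dvdE residue_frac_mult_self)
    then have "(\<Sum>h\<in>Gm ?m. chi (residue_frac f (h * ?q))) = (\<Sum>h\<in>Gm ?m. 1)"
      by (simp only: chi_0)
    then show ?thesis using True by (simp add: card_Gm)
  qed (simp add: sum_chi_residue[OF assms(1)])
  finally have "(\<Sum>y\<in>#poly_lattice d g f. \<Prod>i\<in>u. wal (k i) (y i)) = 2 ^ ?m * of_bool (f dvd ?q)" .
  moreover have "1 / 2 ^ (\<Sum>i\<in>u. mu (k i)) = (\<Prod>i\<in>u. 1 / 2 ^ mu (k i) :: real)"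
    by (simp add: power_sum prod_dividef)
  ultimately show "1 / 2 ^ (\<Sum>i\<in>u. mu (k i)) *
      \<bar>1 / 2 ^ ?m * (\<Sum>y\<in>#poly_lattice d g f. \<Prod>i\<in>u. wal (k i) (y i))\<bar> =
      (\<Prod>i\<in>u. 1 / 2 ^ mu (k i)) * of_bool (f dvd ?q)"
    by simp
qed

text \<open>The dual net condition sees only the components in \<open>u\<close>, so figures of merit
  from earlier dimensions can be reused when a component is appended.\<close>

lemma merit_E_restrict:
  assumes "u \<subseteq> {1..d}" "d \<le> d'" "\<And>i. i \<in> u \<Longrightarrow> g i = g' i"
    and "irreducible f"
  shows "merit_E (degree f) (poly_lattice d g f) u = merit_E (degree f) (poly_lattice d' g' f) u"
proof -
  have "u \<subseteq> {1..d'}" using assms(1,2) by fastforce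
  show ?thesis
    unfolding merit_E_lattice[OF assms(4,1)] merit_E_lattice[OF assms(4) \<open>u \<subseteq> {1..d'}\<close>]
    using assms(3) by (simp cong: sum.cong)
qed

text \<open>With generator 1 the dual net condition asks \<open>f\<close> to divide a nonzero
  polynomial of smaller degree. This is the base of the component-by-component induction.\<close>

lemma merit_E_single:
  assumes "irreducible f" "d \<ge> 1" "g 1 = 1"
  shows "merit_E (degree f) (poly_lattice d g f) {1} = 0"
proof -
  have "\<not> f dvd nat_poly (k 1)" if k: "k \<in> (\<Pi>\<^sub>E i\<in>{1}. {1..2 ^ degree f - 1 :: nat})" for k
  proof
    assume "f dvd nat_poly (k 1)"
    have "k 1 \<in> {1..2 ^ degree f - 1}" using k by (rule PiE_mem) simp
    moreover have "(0::nat) < 2 ^ degree f" by simp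
    ultimately have "k 1 \<ge> 1" "k 1 < 2 ^ degree f" by auto
    then show False using nat_poly_neq_0 Gm_dvd_imp_0[OF nat_poly_Gm \<open>f dvd nat_poly (k 1)\<close>] by blast
  qed
  then have "(\<Prod>i\<in>{1}. 1 / 2 ^ mu (k i)) * of_bool (f dvd (\<Sum>i\<in>{1}. nat_poly (k i) * g i)) = (0::real)"
    if "k \<in> (\<Pi>\<^sub>E i\<in>{1}. {1..2 ^ degree f - 1 :: nat})" for k
    using that assms(3) by (simp del: One_nat_def)
  moreover have "{1} \<subseteq> {1..d}" using assms(2) by simp
  ultimately show ?thesis
    by (subst merit_E_lattice[OF assms(1)]) (simp_all only: sum.neutral_const cong: sum.cong)
qed

text \<open>As \<open>d \<in> u\<close>, the entry \<open>k d\<close> is positive and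
  \<open>nat_poly (k d)\<close> is invertible modulo \<open>f\<close>, so at most one
  \<open>q\<close> solves the congruence. What remains factorises over the coordinates into copies
  of m/2.\<close>

lemma merit_E_sum_last_component:
  assumes "irreducible f" "u \<subseteq> {1..d}" "d \<in> u"
  shows "(\<Sum>q\<in>Gm (degree f). merit_E (degree f) (poly_lattice d (g(d := q)) f) u)
    \<le> (real (degree f) / 2) ^ card u"
proof -
  let ?m = "degree f" and ?K = "\<Pi>\<^sub>E i\<in>u. {1..2 ^ degree f - 1 :: nat}"
  have "finite u" using assms(2) by (rule finite_subset) simp
  have le1: "(\<Sum>q\<in>Gm ?m. of_bool (f dvd (\<Sum>i\<in>u. nat_poly (k i) * (g(d := q)) i))) \<le> (1::real)"
    if k: "k \<in> ?K" for k
  proof -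
    have kd: "k d \<in> {1..2 ^ degree f - 1}" using k assms(3) by (rule PiE_mem)
    moreover have "(0::nat) < 2 ^ ?m" by simp
    ultimately have "k d \<ge> 1" "k d < 2 ^ ?m" by auto
    then have nd: "\<not> f dvd nat_poly (k d)"
      using nat_poly_neq_0 Gm_dvd_imp_0[OF nat_poly_Gm] by blast
    define c where "c = (\<Sum>i\<in>u - {d}. nat_poly (k i) * g i)"
    have eq: "(\<Sum>i\<in>u. nat_poly (k i) * (g(d := q)) i) = nat_poly (k d) * q + c" for q
      unfolding c_def using \<open>finite u\<close> assms(3) by (subst sum.remove[of u d]) (auto intro!: sum.cong)
    have uni: "q = q'" if "q \<in> Gm ?m" "q' \<in> Gm ?m"
      "f dvd nat_poly (k d) * q + c" "f dvd nat_poly (k d) * q' + c" for q q'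
    proof -
      have "f dvd (nat_poly (k d) * q + c) - (nat_poly (k d) * q' + c)" by (intro dvd_diff that)
      then have "f dvd nat_poly (k d) * (q - q')" by (simp only: right_diff_distrib add_diff_add diff_self add_0_right)
      then have "f dvd q - q'"
        using prime_elem_dvd_multD[OF prime_elem_if_irreducible[OF assms(1)]] nd by blast
      then have "q - q' = 0" using Gm_dvd_imp_0 Gm_diff that by blast
      then show "q = q'" by (simp only: right_minus_eq)
    qed
    have "(\<Sum>q\<in>Gm ?m. of_bool (f dvd nat_poly (k d) * q + c)) = real (card {q\<in>Gm ?m. f dvd nat_poly (k d) * q + c})"
      by (simp add: finite_Gm Int_def)
    also have "\<dots> \<le> 1"
    proof -
      have "card {q\<in>Gm ?m. f dvd nat_poly (k d) * q + c} \<le> Suc 0"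
        by (subst card_le_Suc0_iff_eq) (auto simp: finite_Gm intro: uni)
      then show ?thesis by simp
    qed
    finally show ?thesis by (simp only: eq)
  qed
  have "(\<Sum>q\<in>Gm ?m. merit_E ?m (poly_lattice d (g(d := q)) f) u) =
      (\<Sum>k\<in>?K. (\<Prod>i\<in>u. 1 / 2 ^ mu (k i)) *
        (\<Sum>q\<in>Gm ?m. of_bool (f dvd (\<Sum>i\<in>u. nat_poly (k i) * (g(d := q)) i))))"
    by (simp only: merit_E_lattice[OF assms(1,2)] sum_distrib_left) (rule sum.swap)
  also have "\<dots> \<le> (\<Sum>k\<in>?K. (\<Prod>i\<in>u. 1 / 2 ^ mu (k i)) * 1)"
    by (intro sum_mono mult_left_mono le1 prod_nonneg) auto
  also have "\<dots> = (\<Prod>i\<in>u. \<Sum>k=1..2 ^ ?m - 1. 1 / 2 ^ mu k)"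
    using \<open>finite u\<close> by (subst prod_sum_PiE) auto
  also have "\<dots> = (real ?m / 2) ^ card u"
    by (simp only: sum_inverse_power_mu prod_constant)
  finally show ?thesis .
qed

text \<open>The minimum over the last component is at most the average, and for each wave vector with
  nonzero last entry at most one of the \<open>2\<^sup>m\<close> choices of \<open>g\<^sub>d\<close> lies in the dual net.\<close>

lemma merit_B_cbc:
  fixes a b :: "nat \<Rightarrow> real"
  assumes ab: "\<And>i. i \<ge> 1 \<Longrightarrow> a i < b i"
    and \<gamma>: "\<And>u. finite u \<Longrightarrow> u \<subseteq> {1..} \<Longrightarrow> \<gamma> u > 0"
    and irr: "irreducible f"
    and cbc: "cbc_constructed a b \<gamma> s g f"
    and "1 \<le> d" "d \<le> s"
  shows "merit_B a b \<gamma> d g f \<le> 1 / 2 ^ degree f *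
    (\<Sum>u\<in>Pow {1..d} - {{}}. \<gamma> u * (\<Prod>i\<in>u. b i - a i) * (real (degree f) / 2) ^ card u)"
  using \<open>1 \<le> d\<close> \<open>d \<le> s\<close>
proof (induction d rule: nat_induct_at_least)
  case base
  have "Pow {1..1::nat} - {{}} = {{1}}" by auto
  moreover have "g 1 = 1" using cbc by (simp add: cbc_constructed_def)
  moreover have "\<gamma> {1} > 0" "a 1 < b 1" by (auto intro: \<gamma> ab)
  ultimately show ?case using merit_E_single[OF irr, of 1 g] by (simp add: merit_B_def)
next
  case (Suc d)
  let ?m = "degree f" and ?w = "\<lambda>u. \<gamma> u * (\<Prod>i\<in>u. b i - a i)"
  let ?new = "{u\<in>Pow {1..Suc d}. Suc d \<in> u}"
  have split: "Pow {1..Suc d} - {{}} = (Pow {1..d} - {{}}) \<union> ?new"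
    by (auto simp: atLeastAtMostSuc_conv)
  have disj: "(Pow {1..d} - {{}}) \<inter> ?new = {}" by auto
  have w: "0 \<le> ?w u" if "u \<subseteq> {1..Suc d}" for u
  proof -
    have "finite u" using that by (rule finite_subset) simp
    moreover have "u \<subseteq> {1..}" using that by auto
    ultimately have "0 < \<gamma> u" by (rule \<gamma>)
    moreover have "0 \<le> b i - a i" if "i \<in> u" for i
      using ab[of i] \<open>u \<subseteq> {1..}\<close> that by force
    ultimately show ?thesis by (intro mult_nonneg_nonneg prod_nonneg) auto
  qed
  \<comment> \<open>Sets without the new index do not see \<open>q\<close>; the induction hypothesis
    covers them, and only the sets in \<open>?new\<close> take part in the averaging.\<close>
  have B: "merit_B a b \<gamma> (Suc d) (g(Suc d := q)) f = merit_B a b \<gamma> d g f +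
      (\<Sum>u\<in>?new. ?w u * merit_E ?m (poly_lattice (Suc d) (g(Suc d := q)) f) u)" for q
  proof -
    have "merit_E ?m (poly_lattice (Suc d) (g(Suc d := q)) f) u = merit_E ?m (poly_lattice d g f) u"
      if "u \<in> Pow {1..d} - {{}}" for u
      using that by (intro merit_E_restrict[symmetric] irr) auto
    then show ?thesis
      unfolding merit_B_def split by (subst sum.union_disjoint[OF _ _ disj]) auto
  qed
  have min: "merit_B a b \<gamma> (Suc d) g f \<le> merit_B a b \<gamma> (Suc d) (g(Suc d := q)) f" if "q \<in> Gm ?m" for q
  proof -
    have "Suc d \<in> {2..s}" using Suc by auto
    then have "is_arg_min (\<lambda>q. merit_B a b \<gamma> (Suc d) (g(Suc d := q)) f) (\<lambda>q. q \<in> Gm ?m) (g (Suc d))"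
      using cbc by (auto simp: cbc_constructed_def)
    then show ?thesis using that unfolding is_arg_min_def by (force simp: not_less)
  qed
  have "2 ^ ?m * merit_B a b \<gamma> (Suc d) g f = (\<Sum>q\<in>Gm ?m. merit_B a b \<gamma> (Suc d) g f)"
    by (simp add: card_Gm)
  also have "\<dots> \<le> (\<Sum>q\<in>Gm ?m. merit_B a b \<gamma> (Suc d) (g(Suc d := q)) f)"
    by (intro sum_mono min)
  also have "\<dots> = 2 ^ ?m * merit_B a b \<gamma> d g f +
      (\<Sum>u\<in>?new. ?w u * (\<Sum>q\<in>Gm ?m. merit_E ?m (poly_lattice (Suc d) (g(Suc d := q)) f) u))"
    unfolding B sum.distrib sum_distrib_left by (subst (2) sum.swap) (simp add: card_Gm sum_distrib_left)
  also have "\<dots> \<le> 2 ^ ?m * merit_B a b \<gamma> d g f + (\<Sum>u\<in>?new. ?w u * (real ?m / 2) ^ card u)"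
    by (intro add_left_mono sum_mono mult_left_mono merit_E_sum_last_component irr w) auto
  also have "\<dots> \<le> (\<Sum>u\<in>Pow {1..d} - {{}}. ?w u * (real ?m / 2) ^ card u) + (\<Sum>u\<in>?new. ?w u * (real ?m / 2) ^ card u)"
    using Suc by (simp add: field_simps)
  also have "\<dots> = (\<Sum>u\<in>Pow {1..Suc d} - {{}}. ?w u * (real ?m / 2) ^ card u)"
    unfolding split by (rule sum.union_disjoint[OF _ _ disj, symmetric]) auto
  finally show ?case by (simp add: field_simps)
qed

subsection \<open>Dyadic sums of Walsh functions\<close>

text \<open>The expansion of p / 2^m lists the \<open>m\<close> binary digits of \<open>p\<close>
  from the top, hence the reversed index.\<close>

lemma dyadic_digit_grid:
  assumes "l < m"
  shows "dyadic_digit (real p / 2 ^ m) (Suc l) = p div 2 ^ (m - 1 - l) mod 2"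
proof -
  have "(2::real) ^ m = 2 ^ Suc l * 2 ^ (m - 1 - l)"
    using assms by (simp flip: power_add power_Suc)
  then have "2 ^ Suc l * (real p / 2 ^ m) = real p / real (2 ^ (m - 1 - l))" by simp
  then have "\<lfloor>2 ^ Suc l * (real p / 2 ^ m)\<rfloor> = int (p div 2 ^ (m - 1 - l))"
    by (simp only: floor_divide_of_nat_eq)
  then have "dyadic_digit (real p / 2 ^ m) (Suc l) = nat (int (p div 2 ^ (m - 1 - l)) mod 2)"
    by (simp only: dyadic_digit_def)
  also have "\<dots> = p div 2 ^ (m - 1 - l) mod 2"
    by (simp add: nat_mod_distrib)
  finally show ?thesis .
qed

lemma wal_0 [simp]: "wal 0 x = 1"
  by (simp add: wal_def)

text \<open>The product is extended from \<open>mu k\<close> to \<open>m\<close> factors by ones, so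
  that its length no longer depends on \<open>k\<close> and sums over \<open>k\<close> can be
  factorised.\<close>

lemma wal_grid:
  assumes "k < 2 ^ m"
  shows "wal k (real p / 2 ^ m) = (\<Prod>l<m. ((- 1) ^ (p div 2 ^ (m - 1 - l) mod 2)) ^ (k div 2 ^ l mod 2))"
proof -
  have "wal k (real p / 2 ^ m) = (\<Prod>l<mu k. ((- 1) ^ (p div 2 ^ (m - 1 - l) mod 2)) ^ (k div 2 ^ l mod 2))"
    unfolding wal_def power_sum
    using mu_le[OF assms] by (intro prod.cong refl) (simp add: dyadic_digit_grid power_mult[symmetric] mult.commute)
  also have "\<dots> = (\<Prod>l<m. ((- 1) ^ (p div 2 ^ (m - 1 - l) mod 2)) ^ (k div 2 ^ l mod 2))"
  proof (rule prod.mono_neutral_left)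
    show "\<forall>l\<in>{..<m} - {..<mu k}. ((- 1) ^ (p div 2 ^ (m - 1 - l) mod 2)) ^ (k div 2 ^ l mod 2) = (1::real)"
    proof
      fix l assume "l \<in> {..<m} - {..<mu k}"
      have "k < 2 ^ mu k" using mu_bounds(3)[of k] by (cases "k = 0") auto
      also have "(2::nat) ^ mu k \<le> 2 ^ l" using \<open>l \<in> _\<close> by (intro power_increasing) auto
      finally show "((- 1) ^ (p div 2 ^ (m - 1 - l) mod 2)) ^ (k div 2 ^ l mod 2) = (1::real)" by simp
    qed
  qed (use mu_le[OF assms] in auto)
  finally show ?thesis .
qed

text \<open>Expanding the right side chooses 1 or \<open>c l\<close> in each factor; the binary
  digits of \<open>k\<close> encode the choice, and the induction splits off the top digit.\<close>

lemma sum_prod_binary_digits: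
  fixes c :: "nat \<Rightarrow> 'a::comm_semiring_1"
  shows "(\<Sum>k<2 ^ m. \<Prod>l<m. c l ^ (k div 2 ^ l mod 2)) = (\<Prod>l<m. 1 + c l)"
proof (induction m)
  case (Suc m)
  have low: "(\<Prod>l<Suc m. c l ^ (k div 2 ^ l mod 2)) = (\<Prod>l<m. c l ^ (k div 2 ^ l mod 2))"
    if "k < 2 ^ m" for k using that by simp
  have high: "(\<Prod>l<Suc m. c l ^ ((2 ^ m + k) div 2 ^ l mod 2)) = (\<Prod>l<m. c l ^ (k div 2 ^ l mod 2)) * c m"
    if "k < 2 ^ m" for k
  proof -
    have "(2 ^ m + k) div 2 ^ l mod 2 = k div 2 ^ l mod 2" if "l < m" for l
    proof -
      have "(2::nat) ^ m = 2 * 2 ^ (m - Suc l) * 2 ^ l"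
        using that by (simp flip: power_add power_Suc)
      then have "(2 ^ m + k) div 2 ^ l = 2 * 2 ^ (m - Suc l) + k div 2 ^ l" by simp
      then show ?thesis by (metis mod_mult_self4 mult.assoc)
    qed
    then show ?thesis using that by simp
  qed
  have "(\<Sum>k<2 ^ Suc m. \<Prod>l<Suc m. c l ^ (k div 2 ^ l mod 2)) =
      (\<Sum>k<2 ^ m. \<Prod>l<m. c l ^ (k div 2 ^ l mod 2)) + (\<Sum>k<2 ^ m. (\<Prod>l<m. c l ^ (k div 2 ^ l mod 2)) * c m)"
    unfolding sum_two_power_split using low high by (intro arg_cong2[where f = "(+)"] sum.cong refl) auto
  also have "\<dots> = (\<Prod>l<Suc m. 1 + c l)"
    unfolding sum_distrib_right[symmetric] Suc by (simp add: algebra_simps)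
  finally show ?case .
qed simp

text \<open>Orthogonality in the frequency, used to recover a grid function from its coefficients.
  After factorisation, a bit in which \<open>p\<close> and \<open>q\<close> differ yields the factor
  1 + (-1) = 0.\<close>

lemma wal_orthogonal:
  assumes "p < 2 ^ m" "q < 2 ^ m"
  shows "(\<Sum>k<2 ^ m. wal k (real p / 2 ^ m) * wal k (real q / 2 ^ m)) = 2 ^ m * of_bool (p = q)"
proof -
  let ?e = "\<lambda>p l. p div 2 ^ (m - 1 - l) mod (2::nat)"
  have "(\<Sum>k<2 ^ m. wal k (real p / 2 ^ m) * wal k (real q / 2 ^ m)) =
      (\<Sum>k<2 ^ m. \<Prod>l<m. ((- 1) ^ ?e p l * (- 1) ^ ?e q l) ^ (k div 2 ^ l mod 2))"
    by (intro sum.cong refl) (simp add: wal_grid prod.distrib power_mult_distrib)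
  also have "\<dots> = (\<Prod>l<m. 1 + (- 1) ^ ?e p l * (- 1) ^ ?e q l)"
    by (rule sum_prod_binary_digits)
  also have "\<dots> = 2 ^ m * of_bool (p = q)"
  proof (cases "p = q")
    case True
    then show ?thesis by (simp flip: power_mult_distrib)
  next
    case False
    then obtain j where j: "bit p j \<noteq> bit q j" by (auto simp: bit_eq_iff)
    have "j < m"
    proof (rule ccontr)
      assume "\<not> j < m"
      then have "(2::nat) ^ m \<le> 2 ^ j" by simp
      then have "p < 2 ^ j" "q < 2 ^ j" using assms by linarith+
      then show False using j by (simp add: bit_iff_odd)
    qed
    then have "m - 1 - (m - 1 - j) = j" "m - 1 - j < m" by auto
    then have "?e p (m - 1 - j) \<noteq> ?e q (m - 1 - j)"
      using j by (auto simp: bit_iff_odd even_iff_mod_2_eq_zero)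
    then have "1 + (- 1) ^ ?e p (m - 1 - j) * (- 1) ^ ?e q (m - 1 - j) = (0::real)"
      using mod_less_divisor[of 2 "p div 2 ^ (m - 1 - (m - 1 - j))"]
        mod_less_divisor[of 2 "q div 2 ^ (m - 1 - (m - 1 - j))"]
      by (auto simp: less_2_cases_iff)
    then have "(\<Prod>l<m. 1 + (- 1) ^ ?e p l * (- 1) ^ ?e q l) = (0::real)"
      using \<open>m - 1 - j < m\<close> by (intro prod_zero) auto
    then show ?thesis using False by simp
  qed
  finally show ?thesis .
qed

lemma sum_lessThan_add:
  fixes t :: "nat \<Rightarrow> 'a::comm_monoid_add"
  shows "(\<Sum>j<n + r. t j) = (\<Sum>j<n. t j) + (\<Sum>j<r. t (n + j))"
  by (induction r) (simp_all add: add.assoc)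

lemma sum_square_wave:
  assumes "r \<le> 2 * P"
  shows "(\<Sum>t<r. (- 1) ^ (t div P)) = (if r \<le> P then real r else 2 * real P - real r)"
  using assms
proof (induction r)
  case (Suc r)
  show ?case
  proof (cases "r < P")
    case False
    then have "r div P = 1" using Suc.prems by (intro div_nat_eqI) auto
    then show ?thesis using Suc False by (auto split: if_splits)
  qed (use Suc in simp)
qed simp

text \<open>The sign \<sigma> is constant on every full period, so full periods cancel. A partial
  sum is therefore that of one incomplete period, which climbs to at most \<open>P\<close> before it
  descends.\<close>

lemma sum_modulated_square_wave:
  fixes \<sigma> :: "nat \<Rightarrow> real"
  assumes P: "P > 0" and w: "\<And>j. j < 2 * P * n \<Longrightarrow> w j = \<sigma> (j div (2 * P)) * (- 1) ^ (j div P)"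
    and \<sigma>: "\<And>q. \<bar>\<sigma> q\<bar> = 1"
  shows "(\<Sum>j<2 * P * n. w j) = 0" "J \<le> 2 * P * n \<Longrightarrow> \<bar>\<Sum>j<J. w j\<bar> \<le> P"
proof -
  have block: "(\<Sum>j<2 * P * q + r. w j) = (\<Sum>j<2 * P * q. w j) + \<sigma> q * (\<Sum>t<r. (- 1) ^ (t div P))"
    if "r \<le> 2 * P" "2 * P * q + r \<le> 2 * P * n" for q r
  proof -
    have "w (2 * P * q + j) = \<sigma> q * (- 1) ^ (j div P)" if "j < r" for j
    proof -
      have "(2 * P * q + j) div (2 * P) = q"
        using that \<open>r \<le> 2 * P\<close> by (intro div_nat_eqI) auto
      moreover have "(2 * P * q + j) div P = 2 * q + j div P"
        using P by (metis div_mult_self3 mult.assoc mult.commute not_less0)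
      ultimately show ?thesis using w[of "2 * P * q + j"] that \<open>_ + r \<le> _\<close> by (simp add: power_add)
    qed
    then show ?thesis by (simp add: sum_lessThan_add sum_distrib_left)
  qed
  have zero: "(\<Sum>j<2 * P * q. w j) = 0" if "q \<le> n" for q
    using that
  proof (induction q)
    case (Suc q)
    have *: "2 * P * Suc q = 2 * P * q + 2 * P" by simp
    have "2 * P * q + 2 * P \<le> 2 * P * n" unfolding *[symmetric] using Suc.prems by (intro mult_le_mono2)
    from block[OF order_refl this] show ?case using Suc P unfolding * by (simp add: sum_square_wave)
  qed simp
  show "(\<Sum>j<2 * P * n. w j) = 0" by (rule zero) simp
  assume J: "J \<le> 2 * P * n"
  have eq: "J = 2 * P * (J div (2 * P)) + J mod (2 * P)" by simp
  have r: "J mod (2 * P) < 2 * P" using P by (intro mod_less_divisor) simp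
  have q: "J div (2 * P) \<le> n" using J P by (metis div_le_mono div_mult_self1_is_m mult_pos_pos zero_less_numeral)
  have "(\<Sum>j<J. w j) = \<sigma> (J div (2 * P)) * (\<Sum>t<J mod (2 * P). (- 1) ^ (t div P))"
    using block[of "J mod (2 * P)" "J div (2 * P)"] zero[OF q] r J eq by simp
  also have "\<bar>\<dots>\<bar> \<le> P"
    using r by (simp add: abs_mult \<sigma> sum_square_wave)
  finally show "\<bar>\<Sum>j<J. w j\<bar> \<le> P" .
qed

lemma wal_partial_sums:
  assumes k: "1 \<le> k" "k < 2 ^ m"
  shows "(\<Sum>j<2 ^ m. wal k (real j / 2 ^ m)) = 0"
    and "J \<le> 2 ^ m \<Longrightarrow> \<bar>\<Sum>j<J. wal k (real j / 2 ^ m)\<bar> \<le> 2 ^ m / 2 ^ mu k"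
proof -
  define l where "l = mu k - 1"
  have l: "mu k = Suc l" "l < m" using mu_bounds(1)[OF k(1)] mu_le[OF k(2)] by (auto simp: l_def)
  \<comment> \<open>The half period of the fastest oscillation of \<open>wal k\<close>, which comes
    from the leading digit of \<open>k\<close>.\<close>
  define P :: nat where "P = 2 ^ (m - 1 - l)"
  have top: "k div 2 ^ l mod 2 = 1"
  proof -
    have "2 ^ l \<le> k" "k < 2 ^ l * 2" using mu_bounds[OF k(1)] l by auto
    then have "k div 2 ^ l = 1" by (intro div_nat_eqI) auto
    then show ?thesis by simp
  qed
  \<comment> \<open>The lower digits of \<open>k\<close> are paired with digits of \<open>j\<close>
    that do not change within a full period of length 2P.\<close>
  define \<sigma> :: "nat \<Rightarrow> real" where
    "\<sigma> = (\<lambda>q. \<Prod>i<l. (- 1) ^ ((k div 2 ^ i mod 2) * (q div 2 ^ (l - 1 - i) mod 2)))"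
  have w: "wal k (real j / 2 ^ m) = \<sigma> (j div (2 * P)) * (- 1) ^ (j div P)" for j
  proof -
    have "dyadic_digit (real j / 2 ^ m) (Suc i) = j div (2 * P) div 2 ^ (l - 1 - i) mod 2" if "i < l" for i
    proof -
      have "2 * P * 2 ^ (l - 1 - i) = 2 ^ (m - 1 - i)"
        using that l(2) by (simp add: P_def flip: power_add power_Suc)
      then have "j div (2 * P) div 2 ^ (l - 1 - i) = j div 2 ^ (m - 1 - i)"
        by (simp only: div_mult2_eq[symmetric])
      then show ?thesis using that l(2) by (simp add: dyadic_digit_grid)
    qed
    then have "wal k (real j / 2 ^ m) = \<sigma> (j div (2 * P)) * (- 1) ^ (dyadic_digit (real j / 2 ^ m) (Suc l))"
      by (simp add: wal_def l(1) power_add power_sum \<sigma>_def top)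
    also have "dyadic_digit (real j / 2 ^ m) (Suc l) = j div P mod 2"
      by (simp add: dyadic_digit_grid l(2) P_def)
    also have "(- 1) ^ (j div P mod 2) = (- 1 :: real) ^ (j div P)"
      by (cases "even (j div P)") (auto simp: even_iff_mod_2_eq_zero)
    finally show ?thesis .
  qed
  have n: "2 * P * 2 ^ l = 2 ^ m" using l(2) by (simp add: P_def flip: power_add power_Suc)
  have *: "P > 0" "\<bar>\<sigma> q\<bar> = 1" for q by (simp_all add: P_def \<sigma>_def abs_prod power_abs)
  have PP: "real P = 2 ^ m / 2 ^ mu k" using arg_cong[OF n, of real] by (simp add: l(1) field_simps)
  note sq = sum_modulated_square_wave[of P "2 ^ l" "\<lambda>j. wal k (real j / 2 ^ m)" \<sigma>, OF *(1) w *(2), unfolded n PP]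
  show "(\<Sum>j<2 ^ m. wal k (real j / 2 ^ m)) = 0" by (rule sq(1))
  show "\<bar>\<Sum>j<J. wal k (real j / 2 ^ m)\<bar> \<le> 2 ^ m / 2 ^ mu k" if "J \<le> 2 ^ m" by (rule sq(2)[OF that])
qed

section \<open>Summation by parts and the mean value inequality\<close>

lemma abel_summation:
  fixes w x :: "nat \<Rightarrow> 'a::comm_ring"
  shows "(\<Sum>j<Suc n. w j * x j) = (\<Sum>j<Suc n. w j) * x n - (\<Sum>j<n. (\<Sum>i<Suc j. w i) * (x (Suc j) - x j))"
  by (induction n) (simp_all add: algebra_simps)

lemma derivative_bound_diff:
  fixes h h' :: "real \<Rightarrow> real"
  assumes h: "\<And>t. t \<in> {l..r} \<Longrightarrow> (h has_vector_derivative h' t) (at t within {l..r})"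
    and M: "\<And>t. t \<in> {l..r} \<Longrightarrow> \<bar>h' t\<bar> \<le> M"
    and "x \<in> {l..r}" "y \<in> {l..r}"
  shows "\<bar>h x - h y\<bar> \<le> M * \<bar>x - y\<bar>"
proof -
  have "norm (h x - h y) \<le> M * norm (x - y)"
  proof (rule differentiable_bound[of "{l..r}" h "\<lambda>t d. d * h' t"])
    show "(h has_derivative (\<lambda>d. d * h' t)) (at t within {l..r})" if "t \<in> {l..r}" for t
      using h[OF that] by (simp add: has_vector_derivative_def)
    show "onorm (\<lambda>d. d * h' t) \<le> M" if "t \<in> {l..r}" for t
      using M[OF that] order_trans[OF abs_ge_zero M[OF that]]
      by (intro onorm_bound) (auto simp: abs_mult mult.commute[of M] intro: mult_left_mono)
  qed (use assms in auto)
  then show ?thesis by simp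
qed

text \<open>Summation by parts: the boundary term carries the total weight 0, each partial sum is at
  most \<open>c\<close>, and the increments of \<open>h\<close> along the nondecreasing nodes add up
  to at most M (r - l).\<close>

lemma weighted_sum_derivative_bound:
  fixes h h' :: "real \<Rightarrow> real"
  assumes h: "\<And>t. t \<in> {l..r} \<Longrightarrow> (h has_vector_derivative h' t) (at t within {l..r})"
    and M: "\<And>t. t \<in> {l..r} \<Longrightarrow> \<bar>h' t\<bar> \<le> M"
    and z: "\<And>j. j < N \<Longrightarrow> z j \<in> {l..r}" "\<And>j. Suc j < N \<Longrightarrow> z j \<le> z (Suc j)"
    and w: "(\<Sum>j<N. w j) = 0" "\<And>J. J \<le> N \<Longrightarrow> \<bar>\<Sum>j<J. w j\<bar> \<le> c"
    and "N > 0"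
  shows "\<bar>\<Sum>j<N. w j * h (z j)\<bar> \<le> c * (r - l) * M"
proof -
  obtain n where n: "N = Suc n" using \<open>N > 0\<close> by (metis gr0_implies_Suc)
  have c: "0 \<le> c" using w(2)[of 0] by simp
  have M0: "0 \<le> M" using M[of "z 0"] z(1)[of 0] \<open>N > 0\<close> by (smt (verit))
  have "\<bar>\<Sum>j<N. w j * h (z j)\<bar> = \<bar>\<Sum>j<n. (\<Sum>i<Suc j. w i) * (h (z (Suc j)) - h (z j))\<bar>"
    using w(1) unfolding n abel_summation by (simp del: sum.lessThan_Suc)
  also have "\<dots> \<le> (\<Sum>j<n. c * (M * (z (Suc j) - z j)))"
  proof (rule order_trans[OF sum_abs sum_mono])
    fix j assume j: "j \<in> {..<n}"
    have "\<bar>h (z (Suc j)) - h (z j)\<bar> \<le> M * \<bar>z (Suc j) - z j\<bar>"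
      using j n by (intro derivative_bound_diff[OF h M] z(1)) auto
    moreover have "z j \<le> z (Suc j)" using j n by (intro z(2)) auto
    ultimately have "\<bar>h (z (Suc j)) - h (z j)\<bar> \<le> M * (z (Suc j) - z j)" by simp
    moreover have "\<bar>\<Sum>i<Suc j. w i\<bar> \<le> c" using j n by (intro w(2)) auto
    ultimately show "\<bar>(\<Sum>i<Suc j. w i) * (h (z (Suc j)) - h (z j))\<bar> \<le> c * (M * (z (Suc j) - z j))"
      unfolding abs_mult by (intro mult_mono c) auto
  qed
  also have "\<dots> = c * M * (z n - z 0)"
    by (simp only: sum_distrib_left[symmetric] sum_lessThan_telescope mult.assoc)
  also have "\<dots> \<le> c * M * (r - l)"
    using z(1)[of n] z(1)[of 0] n c M0 by (intro mult_left_mono) auto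
  finally show ?thesis by (simp add: mult.commute mult.left_commute)
qed

subsection \<open>Walsh coefficients of sampled functions\<close>

text \<open>Written as an iterated sum along a list, because the order of the variables has to
  follow the list recursion of \<open>mixed_partial\<close>.\<close>

primrec weighted_grid_sum ::
  "nat \<Rightarrow> (nat \<Rightarrow> nat \<Rightarrow> real) \<Rightarrow> (nat \<Rightarrow> nat \<Rightarrow> real) \<Rightarrow> nat list \<Rightarrow> ((nat \<Rightarrow> real) \<Rightarrow> real) \<Rightarrow> (nat \<Rightarrow> real) \<Rightarrow> real"
where
  "weighted_grid_sum N w z [] F x = F x"
| "weighted_grid_sum N w z (i # is) F x = (\<Sum>j<N. w i j * weighted_grid_sum N w z is F (x(i := z i j)))"

lemma weighted_grid_sum_append:
  "weighted_grid_sum N w z (xs @ ys) F x = weighted_grid_sum N w z xs (weighted_grid_sum N w z ys F) x"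
  by (induction xs arbitrary: x) simp_all

lemma weighted_grid_sum_PiE:
  assumes "distinct is"
  shows "(\<Sum>j\<in>(\<Pi>\<^sub>E i\<in>set is. {..<N}). (\<Prod>i\<in>set is. w i (j i)) * F (\<lambda>i. if i \<in> set is then z i (j i) else x i)) =
    weighted_grid_sum N w z is F x"
  using assms
proof (induction "is" arbitrary: x)
  case (Cons i "is")
  let ?S = "set is" and ?P = "\<Pi>\<^sub>E i\<in>set is. {..<N}"
  have i: "i \<notin> ?S" using Cons.prems by simp
  have "(\<Sum>j\<in>(\<Pi>\<^sub>E i\<in>set (i # is). {..<N}). (\<Prod>i\<in>set (i # is). w i (j i)) * F (\<lambda>k. if k \<in> set (i # is) then z k (j k) else x k)) =
      (\<Sum>(y, j)\<in>{..<N} \<times> ?P. w i y * ((\<Prod>i\<in>?S. w i (j i)) * F (\<lambda>k. if k \<in> ?S then z k (j k) else (x(i := z i y)) k)))"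
  proof (rule sum.reindex_cong[of "\<lambda>(y, g). g(i := y)"])
    show "inj_on (\<lambda>(y, g). g(i := y)) ({..<N} \<times> ?P)"
      by (rule inj_combinator[OF i])
    show "(\<Pi>\<^sub>E i\<in>set (i # is). {..<N}) = (\<lambda>(y, g). g(i := y)) ` ({..<N} \<times> ?P)"
      by (simp add: PiE_insert_eq)
    fix p assume "p \<in> {..<N} \<times> ?P"
    obtain y j where p: "p = (y, j)" by (cases p)
    have "(\<Prod>k\<in>set (i # is). w k ((j(i := y)) k)) = w i y * (\<Prod>k\<in>?S. w k (j k))"
      using i by (auto intro!: prod.cong arg_cong2[where f = "(*)"])
    moreover have "(\<lambda>k. if k \<in> set (i # is) then z k ((j(i := y)) k) else x k) =
        (\<lambda>k. if k \<in> ?S then z k (j k) else (x(i := z i y)) k)"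
      using i by auto
    ultimately show "(\<Prod>k\<in>set (i # is). w k ((case p of (y, g) \<Rightarrow> g(i := y)) k)) *
          F (\<lambda>k. if k \<in> set (i # is) then z k ((case p of (y, g) \<Rightarrow> g(i := y)) k) else x k) =
        (case p of (y, j) \<Rightarrow> w i y * ((\<Prod>i\<in>?S. w i (j i)) * F (\<lambda>k. if k \<in> ?S then z k (j k) else (x(i := z i y)) k)))"
      unfolding p prod.case by (simp only: mult.assoc)
  qed
  also have "\<dots> = (\<Sum>y<N. w i y * weighted_grid_sum N w z is F (x(i := z i y)))"
  proof -
    have "distinct is" using Cons.prems by simp
    then show ?thesis
      by (simp only: sum.cartesian_product[symmetric] sum_distrib_left[symmetric] Cons.IH)
  qed
  finally show ?case by simp
qed simp

lemma box_on_upd: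
  assumes "x \<in> box_on a b s" "i \<in> {1..s}" "t \<in> {a i..b i}"
  shows "x(i := t) \<in> box_on a b s"
proof -
  have "insert i {1..s} = {1..s}" using assms(2) by auto
  then show ?thesis using PiE_fun_upd[of t "\<lambda>i. {a i..b i}" i x "{1..s}"] assms by (simp add: box_on_def)
qed

lemma box_on_mem: "x \<in> box_on a b s \<Longrightarrow> i \<in> {1..s} \<Longrightarrow> x i \<in> {a i..b i}"
  unfolding box_on_def by (rule PiE_mem)

lemma mixed_partial_append:
  "mixed_partial a b (xs @ ys) F = mixed_partial a b xs (mixed_partial a b ys F)"
  by (induction xs) simp_all

lemma has_mixed_partial_append:
  "has_mixed_partial a b s (xs @ ys) F \<longleftrightarrow>
    has_mixed_partial a b s ys F \<and> has_mixed_partial a b s xs (mixed_partial a b ys F)"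
  by (induction xs) (auto simp: mixed_partial_append)

lemma has_partial_deriv_has_vector_derivative:
  assumes "has_partial_deriv a b s i F" "x \<in> box_on a b s" "i \<in> {1..s}" "t \<in> {a i..b i}"
  shows "((\<lambda>t. F (x(i := t))) has_vector_derivative partial_deriv a b i F (x(i := t))) (at t within {a i..b i})"
proof -
  have "x(i := t) \<in> box_on a b s" using assms by (intro box_on_upd)
  from bspec[OF assms(1)[unfolded has_partial_deriv_def] this]
  have "(\<lambda>t. F (x(i := t))) differentiable (at t within {a i..b i})"
    by (simp only: fun_upd_upd fun_upd_same)
  then show ?thesis
    unfolding partial_deriv_def fun_upd_upd fun_upd_same by (simp only: vector_derivative_works)
qed

text \<open>Brings the sum over the last variable, innermost by the list order, to the outside,
  where a one-dimensional estimate can act on it.\<close>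

lemma weighted_grid_sum_commute:
  assumes "i \<notin> set is"
  shows "weighted_grid_sum N w z is (\<lambda>x. \<Sum>j<N. v j * F (x(i := y j))) x =
    (\<Sum>j<N. v j * weighted_grid_sum N w z is F (x(i := y j)))"
  using assms
proof (induction "is" arbitrary: x)
  case (Cons k "is")
  then have "i \<noteq> k" "i \<notin> set is" by auto
  then have tw: "x(k := c, i := d) = x(i := d, k := c)" for c d by (auto simp: fun_upd_twist)
  have "weighted_grid_sum N w z (k # is) (\<lambda>x. \<Sum>j<N. v j * F (x(i := y j))) x =
      (\<Sum>l<N. \<Sum>j<N. v j * (w k l * weighted_grid_sum N w z is F (x(i := y j, k := z k l))))"
    unfolding weighted_grid_sum.simps Cons.IH[OF \<open>i \<notin> set is\<close>] tw sum_distrib_left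
    by (intro sum.cong refl) (rule mult.left_commute)
  also have "\<dots> = (\<Sum>j<N. v j * weighted_grid_sum N w z (k # is) F (x(i := y j)))"
    unfolding weighted_grid_sum.simps sum_distrib_left by (rule sum.swap)
  finally show ?case .
qed simp

text \<open>Finite sums over the other coordinates commute with differentiation in \<open>i\<close>;
  thus the partially summed function has a derivative of the same shape, with \<open>F\<close>
  replaced by its partial derivative.\<close>

lemma weighted_grid_sum_has_vector_derivative:
  assumes "i \<notin> set is" "i \<in> {1..s}" "set is \<subseteq> {1..s}" "x \<in> box_on a b s" "t \<in> {a i..b i}"
    and "has_partial_deriv a b s i F"
    and z: "\<And>k j. k \<in> set is \<Longrightarrow> j < N \<Longrightarrow> z k j \<in> {a k..b k}"
  shows "((\<lambda>t. weighted_grid_sum N w z is F (x(i := t))) has_vector_derivative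
    weighted_grid_sum N w z is (partial_deriv a b i F) (x(i := t))) (at t within {a i..b i})"
  using assms(1,3,4) z
proof (induction "is" arbitrary: x)
  case Nil
  show ?case
    unfolding weighted_grid_sum.simps
    by (rule has_partial_deriv_has_vector_derivative) (use Nil assms in auto)
next
  case (Cons k "is")
  have "i \<noteq> k" using Cons.prems by auto
  then have tw: "x(i := d, k := c) = x(k := c, i := d)" for c d by (auto simp: fun_upd_twist)
  have "((\<lambda>t. \<Sum>j<N. w k j * weighted_grid_sum N w z is F (x(k := z k j, i := t))) has_vector_derivative
      (\<Sum>j<N. w k j * weighted_grid_sum N w z is (partial_deriv a b i F) (x(k := z k j, i := t)))) (at t within {a i..b i})"
    using Cons.prems
    by (intro has_vector_derivative_sum has_vector_derivative_mult_right Cons.IH box_on_upd) auto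
  then show ?case unfolding weighted_grid_sum.simps tw .
qed

text \<open>The innermost derivative of a mixed partial is with respect to the last variable, so the
  mean value theorem is applied to that variable first.\<close>

lemma weighted_grid_sum_mixed_partial_bound:
  assumes "distinct is" "set is \<subseteq> {1..s}" "x \<in> box_on a b s"
    and "has_mixed_partial a b s is F"
    and "\<And>x. x \<in> box_on a b s \<Longrightarrow> \<bar>mixed_partial a b is F x\<bar> \<le> M"
    and z: "\<And>i j. i \<in> set is \<Longrightarrow> j < N \<Longrightarrow> z i j \<in> {a i..b i}"
    and L: "\<And>i h h' M. i \<in> set is \<Longrightarrow>
        (\<And>t. t \<in> {a i..b i} \<Longrightarrow> (h has_vector_derivative h' t) (at t within {a i..b i})) \<Longrightarrow>
        (\<And>t. t \<in> {a i..b i} \<Longrightarrow> \<bar>h' t\<bar> \<le> M) \<Longrightarrow>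
        \<bar>\<Sum>j<N. w i j * h (z i j)\<bar> \<le> L i * M"
  shows "\<bar>weighted_grid_sum N w z is F x\<bar> \<le> (\<Prod>i\<in>set is. L i) * M"
  using assms
proof (induction "is" arbitrary: F x rule: rev_induct)
  case (snoc i "is")
  have dist: "i \<notin> set is" "distinct is" "i \<in> {1..s}" "set is \<subseteq> {1..s}" using snoc.prems by auto
  have hp: "has_partial_deriv a b s i F" "has_mixed_partial a b s is (partial_deriv a b i F)"
    using snoc.prems(4) by (auto simp: has_mixed_partial_append)
  have bd: "\<bar>mixed_partial a b is (partial_deriv a b i F) x\<bar> \<le> M" if "x \<in> box_on a b s" for x
    using snoc.prems(5)[OF that] by (simp add: mixed_partial_append)
  have "weighted_grid_sum N w z (is @ [i]) F x =
      (\<Sum>j<N. w i j * weighted_grid_sum N w z is F (x(i := z i j)))"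
  proof -
    have "weighted_grid_sum N w z [i] F = (\<lambda>x. \<Sum>j<N. w i j * F (x(i := z i j)))"
      by (rule ext) simp
    then show ?thesis
      unfolding weighted_grid_sum_append by (simp only: weighted_grid_sum_commute[OF dist(1)])
  qed
  \<comment> \<open>The one-dimensional estimate is used with \<open>h\<close> the sum over the
    remaining variables; its derivative is bounded by the induction hypothesis for
    \<open>partial_deriv a b i F\<close>.\<close>
  also have "\<bar>\<dots>\<bar> \<le> L i * ((\<Prod>i\<in>set is. L i) * M)"
  proof (rule snoc.prems(7))
    fix t assume t: "t \<in> {a i..b i}"
    show "((\<lambda>t. weighted_grid_sum N w z is F (x(i := t))) has_vector_derivative
        weighted_grid_sum N w z is (partial_deriv a b i F) (x(i := t))) (at t within {a i..b i})"
      by (rule weighted_grid_sum_has_vector_derivative[OF dist(1,3,4) snoc.prems(3) t hp(1)])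
         (use snoc.prems(6) in auto)
    show "\<bar>weighted_grid_sum N w z is (partial_deriv a b i F) (x(i := t))\<bar> \<le> (\<Prod>i\<in>set is. L i) * M"
    proof (rule snoc.IH[OF dist(2,4) box_on_upd[OF snoc.prems(3) dist(3) t] hp(2) bd])
      show "\<bar>\<Sum>j<N. w k j * h (z k j)\<bar> \<le> L k * M'"
        if "k \<in> set is" "\<And>t. t \<in> {a k..b k} \<Longrightarrow> (h has_vector_derivative h' t) (at t within {a k..b k})"
          "\<And>t. t \<in> {a k..b k} \<Longrightarrow> \<bar>h' t\<bar> \<le> M'" for k h h' M'
        using that by (intro snoc.prems(7)[of k h h' M']) auto
    qed (use snoc.prems(6) in auto)
  qed simp
  finally show ?case using dist(1) by (simp add: mult.assoc)
qed simp

text \<open>Handles the variables outside \<open>u\<close>, in which no derivative is taken: weights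
  of total absolute mass at most 1 cannot enlarge a uniform bound.\<close>

lemma weighted_grid_sum_abs_bound:
  assumes "set is \<subseteq> {1..s}" "x \<in> box_on a b s"
    and "\<And>x. x \<in> box_on a b s \<Longrightarrow> \<bar>F x\<bar> \<le> M"
    and "\<And>i j. i \<in> set is \<Longrightarrow> j < N \<Longrightarrow> z i j \<in> {a i..b i}"
    and "\<And>i. i \<in> set is \<Longrightarrow> (\<Sum>j<N. \<bar>w i j\<bar>) \<le> 1"
  shows "\<bar>weighted_grid_sum N w z is F x\<bar> \<le> M"
  using assms(1,2,4,5)
proof (induction "is" arbitrary: x)
  case Nil
  then show ?case using assms(3) by simp
next
  case (Cons i "is")
  have M: "0 \<le> M" using assms(3)[OF Cons.prems(2)] by linarith
  have "\<bar>weighted_grid_sum N w z (i # is) F x\<bar> \<le> (\<Sum>j<N. \<bar>w i j\<bar> * M)"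
    unfolding weighted_grid_sum.simps
    using Cons.prems
    by (intro order_trans[OF sum_abs sum_mono]) (auto simp: abs_mult intro!: mult_left_mono Cons.IH box_on_upd)
  also have "\<dots> \<le> 1 * M"
    unfolding sum_distrib_right[symmetric] using Cons.prems M by (intro mult_right_mono) auto
  finally show ?case by simp
qed

lemma grid_sum_mixed_partial_bound:
  fixes N :: nat
  assumes u: "u \<subseteq> {1..s}" and ab: "\<And>i. i \<in> {1..s} \<Longrightarrow> a i \<le> b i"
    and F: "has_mixed_partial a b s (sorted_list_of_set u) F"
      "\<And>x. x \<in> box_on a b s \<Longrightarrow> \<bar>mixed_partial a b (sorted_list_of_set u) F x\<bar> \<le> M"
    and z: "\<And>i j. i \<in> {1..s} \<Longrightarrow> j < N \<Longrightarrow> z i j \<in> {a i..b i}"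
    and w: "\<And>i. i \<in> {1..s} - u \<Longrightarrow> (\<Sum>j<N. \<bar>w i j\<bar>) \<le> 1"
    and L: "\<And>i h h' M. i \<in> u \<Longrightarrow>
        (\<And>t. t \<in> {a i..b i} \<Longrightarrow> (h has_vector_derivative h' t) (at t within {a i..b i})) \<Longrightarrow>
        (\<And>t. t \<in> {a i..b i} \<Longrightarrow> \<bar>h' t\<bar> \<le> M) \<Longrightarrow>
        \<bar>\<Sum>j<N. w i j * h (z i j)\<bar> \<le> L i * M"
  shows "\<bar>\<Sum>j\<in>(\<Pi>\<^sub>E i\<in>{1..s}. {..<N}). (\<Prod>i\<in>{1..s}. w i (j i)) * F (\<lambda>i\<in>{1..s}. z i (j i))\<bar>
    \<le> (\<Prod>i\<in>u. L i) * M"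
proof -
  have "finite u" using u by (rule finite_subset) simp
  let ?c = "sorted_list_of_set ({1..s} - u)" and ?u = "sorted_list_of_set u"
  \<comment> \<open>Any point of the box would do, since the sums overwrite all coordinates in
    \<open>{1..s}\<close>.\<close>
  define x where "x = (\<lambda>i\<in>{1..s}. a i)"
  have x: "x \<in> box_on a b s" using ab by (auto simp: x_def box_on_def)
  have set_u: "set ?u = u" and set_c: "set ?c = {1..s} - u" using \<open>finite u\<close> by auto
  \<comment> \<open>The complement of \<open>u\<close> comes first, so that the sums over
    \<open>u\<close> are innermost and act on \<open>F\<close> itself, in the sorted order used by
    the norm.\<close>
  have "distinct (?c @ ?u)" "set (?c @ ?u) = {1..s}" using u \<open>finite u\<close> by auto
  moreover have "(\<lambda>i. if i \<in> {1..s} then z i (j i) else x i) = (\<lambda>i\<in>{1..s}. z i (j i))" for j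
    by (auto simp: x_def)
  ultimately have "(\<Sum>j\<in>(\<Pi>\<^sub>E i\<in>{1..s}. {..<N}). (\<Prod>i\<in>{1..s}. w i (j i)) * F (\<lambda>i\<in>{1..s}. z i (j i))) =
      weighted_grid_sum N w z (?c @ ?u) F x"
    using weighted_grid_sum_PiE[of "?c @ ?u", where N = N and w = w and F = F and z = z and x = x] by simp
  also have "\<dots> = weighted_grid_sum N w z ?c (weighted_grid_sum N w z ?u F) x"
    by (rule weighted_grid_sum_append)
  also have "\<bar>\<dots>\<bar> \<le> (\<Prod>i\<in>u. L i) * M"
  proof (rule weighted_grid_sum_abs_bound[where a = a and b = b and s = s])
    show "\<bar>weighted_grid_sum N w z ?u F y\<bar> \<le> (\<Prod>i\<in>u. L i) * M" if "y \<in> box_on a b s" for y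
    proof -
      have "\<bar>weighted_grid_sum N w z ?u F y\<bar> \<le> (\<Prod>i\<in>set ?u. L i) * M"
      proof (rule weighted_grid_sum_mixed_partial_bound[OF _ _ that F])
        show "distinct ?u" by simp
        show "set ?u \<subseteq> {1..s}" using u by (simp only: set_u)
        show "z i j \<in> {a i..b i}" if "i \<in> set ?u" "j < N" for i j
          using z[of i j] that u by (auto simp only: set_u)
        show "\<bar>\<Sum>j<N. w i j * h (z i j)\<bar> \<le> L i * M'"
          if "i \<in> set ?u" "\<And>t. t \<in> {a i..b i} \<Longrightarrow> (h has_vector_derivative h' t) (at t within {a i..b i})"
            "\<And>t. t \<in> {a i..b i} \<Longrightarrow> \<bar>h' t\<bar> \<le> M'" for i h h' M'
          using L[of i h h' M'] that by (simp only: set_u)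
      qed
      then show ?thesis by (simp only: set_u)
    qed
  qed (use x z w in auto)
  finally show ?thesis .
qed

lemma sum_mset_swap_sum:
  fixes t :: "'a \<Rightarrow> 'b \<Rightarrow> 'c::comm_monoid_add"
  shows "(\<Sum>y\<in>#P. \<Sum>k\<in>A. t k y) = (\<Sum>k\<in>A. \<Sum>y\<in>#P. t k y)"
  by (induction P) (simp_all add: sum.distrib)

text \<open>Each coordinate carries its own factor 2^(-m): off \<open>u\<close> the weights have
  total mass 1, and on \<open>u\<close> their partial sums are at most 2^(-mu) for frequencies in
  {1..2^m - 1}.\<close>

definition walsh_weight :: "nat \<Rightarrow> nat set \<Rightarrow> (nat \<Rightarrow> nat) \<Rightarrow> nat \<Rightarrow> nat \<Rightarrow> real" where
  "walsh_weight m u k i j = (if i \<in> u then wal (k i) (real j / 2 ^ m) else 1) / 2 ^ m"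

text \<open>The Walsh coefficient of \<open>G\<close> at the wave vector that equals \<open>k\<close> on \<open>u\<close> and vanishes off \<open>u\<close>.\<close>

definition grid_coeff ::
  "nat \<Rightarrow> nat \<Rightarrow> ((nat \<Rightarrow> nat) \<Rightarrow> real) \<Rightarrow> nat set \<Rightarrow> (nat \<Rightarrow> nat) \<Rightarrow> real" where
  "grid_coeff m s G u k =
    (\<Sum>j\<in>(\<Pi>\<^sub>E i\<in>{1..s}. {..<2 ^ m}). (\<Prod>i\<in>{1..s}. walsh_weight m u k i (j i)) * G j)"

text \<open>The indicator of the grid point \<open>p\<close> is a product of one-dimensional
  indicators, each a Walsh sum by orthogonality. Grouping the frequencies by their support
  \<open>u\<close> matches the figure of merit, which sums over nonzero entries only.\<close>

lemma grid_walsh_expansion: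
  assumes p: "p \<in> (\<Pi>\<^sub>E i\<in>{1..s}. {..<2 ^ m})"
  shows "G p = (\<Sum>u\<in>Pow {1..s}. \<Sum>k\<in>(\<Pi>\<^sub>E i\<in>u. {1..2 ^ m - 1}).
    grid_coeff m s G u k * (\<Prod>i\<in>u. wal (k i) (real (p i) / 2 ^ m)))"
proof -
  let ?I = "{1..s}" and ?J = "\<Pi>\<^sub>E i\<in>{1..s}. {..<2 ^ m::nat}" and ?K = "{1..2 ^ m - 1::nat}"
  let ?W = "\<lambda>k j. wal k (real j / 2 ^ m)"
  have delta: "of_bool (j = p) = (\<Sum>u\<in>Pow ?I. \<Sum>k\<in>(\<Pi>\<^sub>E i\<in>u. ?K).
      (\<Prod>i\<in>?I. walsh_weight m u k i (j i)) * (\<Prod>i\<in>u. ?W (k i) (p i)))" if j: "j \<in> ?J" for j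
  proof -
    \<comment> \<open>The frequency 0 is kept apart as 1 / 2^m, so that distributing the product
      selects for each coordinate whether it belongs to the support.\<close>
    have one: "of_bool (j i = p i) = (\<Sum>k\<in>?K. ?W k (j i) * ?W k (p i) / 2 ^ m) + 1 / 2 ^ m"
      if "i \<in> ?I" for i
    proof -
      have lt: "j i < 2 ^ m" "p i < 2 ^ m" using j p that by (auto dest: PiE_mem)
      have K: "?K = {..<2 ^ m} - {0}" by auto
      have "(\<Sum>k\<in>?K. ?W k (j i) * ?W k (p i)) = 2 ^ m * of_bool (j i = p i) - 1"
        unfolding K by (subst sum_diff1) (use wal_orthogonal[OF lt] in auto)
      then show ?thesis by (simp add: sum_divide_distrib[symmetric] field_simps)
    qed
    have "j = p \<longleftrightarrow> (\<forall>i\<in>?I. j i = p i)" using PiE_ext[OF j p] by blast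
    then have "of_bool (j = p) = (\<Prod>i\<in>?I. of_bool (j i = p i) :: real)"
      by (auto intro!: prod_zero)
    also have "\<dots> = (\<Prod>i\<in>?I. (\<Sum>k\<in>?K. ?W k (j i) * ?W k (p i) / 2 ^ m) + 1 / 2 ^ m)"
      by (intro prod.cong refl one)
    also have "\<dots> = (\<Sum>u\<in>Pow ?I. (\<Prod>i\<in>u. \<Sum>k\<in>?K. ?W k (j i) * ?W k (p i) / 2 ^ m) * (\<Prod>i\<in>?I - u. 1 / 2 ^ m))"
      by (rule prod_add) simp
    also have "\<dots> = (\<Sum>u\<in>Pow ?I. \<Sum>k\<in>(\<Pi>\<^sub>E i\<in>u. ?K).
      (\<Prod>i\<in>?I. walsh_weight m u k i (j i)) * (\<Prod>i\<in>u. ?W (k i) (p i)))"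
    proof (rule sum.cong[OF refl])
      fix u assume "u \<in> Pow ?I"
      then have u: "u \<subseteq> ?I" "finite u" by (auto intro: finite_subset)
      have "(\<Prod>i\<in>?I. walsh_weight m u k i (j i)) =
          (\<Prod>i\<in>?I - u. 1 / 2 ^ m) * (\<Prod>i\<in>u. ?W (k i) (j i) / 2 ^ m)" for k
        unfolding prod.subset_diff[OF u(1) finite_atLeastAtMost]
        by (intro arg_cong2[where f = "(*)"] prod.cong refl) (auto simp: walsh_weight_def)
      then have "(\<Prod>i\<in>?I. walsh_weight m u k i (j i)) * (\<Prod>i\<in>u. ?W (k i) (p i)) =
          (\<Prod>i\<in>?I - u. 1 / 2 ^ m) * (\<Prod>i\<in>u. ?W (k i) (j i) * ?W (k i) (p i) / 2 ^ m)" for k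
        by (simp add: prod.distrib prod_dividef)
      then show "(\<Prod>i\<in>u. \<Sum>k\<in>?K. ?W k (j i) * ?W k (p i) / 2 ^ m) * (\<Prod>i\<in>?I - u. 1 / 2 ^ m) =
          (\<Sum>k\<in>(\<Pi>\<^sub>E i\<in>u. ?K). (\<Prod>i\<in>?I. walsh_weight m u k i (j i)) * (\<Prod>i\<in>u. ?W (k i) (p i)))"
        using u(2) by (simp add: prod_sum_PiE sum_distrib_left[symmetric] mult.commute del: One_nat_def)
    qed
    finally show ?thesis .
  qed
  have "G p = (\<Sum>j\<in>?J. if j = p then G j else 0)"
    using p by (subst sum.delta) (auto intro: finite_PiE)
  also have "\<dots> = (\<Sum>j\<in>?J. of_bool (j = p) * G j)" by (intro sum.cong) auto
  also have "\<dots> = (\<Sum>j\<in>?J. \<Sum>u\<in>Pow ?I. \<Sum>k\<in>(\<Pi>\<^sub>E i\<in>u. ?K).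
      (\<Prod>i\<in>?I. walsh_weight m u k i (j i)) * G j * (\<Prod>i\<in>u. ?W (k i) (p i)))"
    by (intro sum.cong refl, simp only: delta sum_distrib_right, intro sum.cong refl)
       (simp only: mult.assoc mult.commute[of "G _"])
  also have "\<dots> = (\<Sum>u\<in>Pow ?I. \<Sum>k\<in>(\<Pi>\<^sub>E i\<in>u. ?K). \<Sum>j\<in>?J.
      (\<Prod>i\<in>?I. walsh_weight m u k i (j i)) * G j * (\<Prod>i\<in>u. ?W (k i) (p i)))"
    by (rule trans[OF sum.swap], rule sum.cong[OF refl], rule sum.swap)
  also have "\<dots> = (\<Sum>u\<in>Pow ?I. \<Sum>k\<in>(\<Pi>\<^sub>E i\<in>u. ?K). grid_coeff m s G u k * (\<Prod>i\<in>u. ?W (k i) (p i)))"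
    by (simp only: grid_coeff_def sum_distrib_right)
  finally show ?thesis .
qed

subsection \<open>Quadrature on a grid of quantiles\<close>

text \<open>Makes product integrals factorise for Lebesgue measure; the countable exhaustion is
  inherited from \<open>lborel\<close>.\<close>

lemma sigma_finite_lebesgue: "sigma_finite_measure (lebesgue :: real measure)"
proof
  obtain A :: "real set set" where A: "countable A" "A \<subseteq> sets lborel" "\<Union>A = space lborel"
      "\<forall>a\<in>A. emeasure lborel a \<noteq> \<infinity>"
    using sigma_finite_measure.sigma_finite_countable[OF sigma_finite_lborel] by blast
  have "A \<subseteq> sets lebesgue" using A(2) by auto
  moreover have "\<forall>a\<in>A. emeasure lebesgue a \<noteq> \<infinity>" using A(2,4) by (auto simp: subset_eq)
  ultimately show "\<exists>A. countable A \<and> A \<subseteq> sets (lebesgue :: real measure) \<and> \<Union>A = space lebesgue \<and> (\<forall>a\<in>A. emeasure lebesgue a \<noteq> \<infinity>)"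
    using A(1,3) by auto
qed

interpretation lebesgue_product: product_sigma_finite "\<lambda>_::nat. lebesgue :: real measure"
  by (simp add: product_sigma_finite_def sigma_finite_lebesgue)

lemma sum_PiE_coord:
  fixes t :: "nat \<Rightarrow> real"
  assumes "finite I" "k \<in> I" "N > 0"
  shows "(\<Sum>j\<in>(\<Pi>\<^sub>E i\<in>I. {..<N}). t (j k) * (\<Prod>i\<in>I. 1 / real N)) = (\<Sum>j<N. t j) / real N"
proof -
  have "(\<Sum>j\<in>(\<Pi>\<^sub>E i\<in>I. {..<N}). t (j k) * (\<Prod>i\<in>I. 1 / real N)) =
      (\<Sum>j\<in>(\<Pi>\<^sub>E i\<in>I. {..<N}). \<Prod>i\<in>I. (if i = k then t (j i) else 1) / real N)"
  proof (rule sum.cong[OF refl])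
    fix j
    have "(\<Prod>i\<in>I. if i = k then t (j i) else 1) = t (j k)"
      using assms by (simp add: prod.delta)
    then show "t (j k) * (\<Prod>i\<in>I. 1 / real N) = (\<Prod>i\<in>I. (if i = k then t (j i) else 1) / real N)"
      by (simp add: prod_dividef power_one_over)
  qed
  also have "\<dots> = (\<Prod>i\<in>I. \<Sum>j<N. (if i = k then t j else 1) / real N)"
    using assms by (subst prod_sum_PiE) auto
  also have "\<dots> = (\<Prod>i\<in>I. if i = k then (\<Sum>j<N. t j) / real N else 1)"
    using assms by (intro prod.cong refl) (auto simp: sum_divide_distrib)
  also have "\<dots> = (\<Sum>j<N. t j) / real N"
    using assms by (simp add: prod.delta)
  finally show ?thesis .
qed

lemma unit_ball_mixed_partial:
  assumes F: "F \<in> unit_ball a b \<gamma> s" and u: "u \<subseteq> {1..s}" and \<gamma>: "\<gamma> u > 0"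
  shows "has_mixed_partial a b s (sorted_list_of_set u) F"
    and "x \<in> box_on a b s \<Longrightarrow> \<bar>mixed_partial a b (sorted_list_of_set u) F x\<bar> \<le> \<gamma> u"
proof -
  show "has_mixed_partial a b s (sorted_list_of_set u) F" using F u by (auto simp: unit_ball_def)
  assume x: "x \<in> box_on a b s"
  let ?S = "SUP x\<in>box_on a b s. ereal \<bar>mixed_partial a b (sorted_list_of_set u) F x\<bar>"
  have "ereal (1 / \<gamma> u) * ereal \<bar>mixed_partial a b (sorted_list_of_set u) F x\<bar> \<le> ereal (1 / \<gamma> u) * ?S"
    using \<gamma> x by (intro ereal_mult_left_mono SUP_upper) auto
  also have "\<dots> \<le> norm_inf a b \<gamma> s F"
    unfolding norm_inf_def using u by (intro Max_ge) auto
  also have "\<dots> \<le> 1" using F by (simp add: unit_ball_def)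
  finally have "1 / \<gamma> u * \<bar>mixed_partial a b (sorted_list_of_set u) F x\<bar> \<le> 1" by simp
  then show "\<bar>mixed_partial a b (sorted_list_of_set u) F x\<bar> \<le> \<gamma> u" using \<gamma> by (simp add: field_simps)
qed

lemma unit_ball_abs_le:
  assumes "F \<in> unit_ball a b \<gamma> s" "\<gamma> {} > 0" "x \<in> box_on a b s"
  shows "\<bar>F x\<bar> \<le> \<gamma> {}"
  using unit_ball_mixed_partial(2)[OF assms(1), of "{}" x] assms by simp

text \<open>The coordinates of \<open>x\<close> are exchanged for those of \<open>y\<close> one at a
  time, and each exchange costs one mean value estimate with a first-order partial
  derivative.\<close>

lemma unit_ball_lipschitz:
  assumes F: "F \<in> unit_ball a b \<gamma> s" and \<gamma>: "\<And>i. i \<in> {1..s} \<Longrightarrow> \<gamma> {i} > 0"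
    and x: "x \<in> box_on a b s" and y: "y \<in> box_on a b s"
  shows "\<bar>F x - F y\<bar> \<le> (\<Sum>i\<in>{1..s}. \<gamma> {i} * \<bar>x i - y i\<bar>)"
proof -
  have mem: "(\<lambda>i. if i \<in> A then y i else x i) \<in> box_on a b s" for A
    using x y by (auto simp: box_on_def PiE_iff extensional_def)
  have "\<bar>F x - F (\<lambda>i. if i \<in> A then y i else x i)\<bar> \<le> (\<Sum>i\<in>A. \<gamma> {i} * \<bar>x i - y i\<bar>)"
    if "A \<subseteq> {1..s}" for A
  proof -
    have "finite A" using that by (rule finite_subset) simp
    then show ?thesis using that
    proof (induction A rule: finite_induct)
      case (insert k A)
      then have k: "k \<in> {1..s}" "k \<notin> A" by auto
      let ?v = "\<lambda>i. if i \<in> A then y i else x i"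
      have pd: "has_partial_deriv a b s k F"
        using unit_ball_mixed_partial(1)[where u = "{k}" and \<gamma> = \<gamma>, OF F] \<gamma>[OF k(1)] k by simp
      have bd: "\<bar>partial_deriv a b k F z\<bar> \<le> \<gamma> {k}" if "z \<in> box_on a b s" for z
        using unit_ball_mixed_partial(2)[where u = "{k}" and \<gamma> = \<gamma>, OF F _ _ that] \<gamma>[OF k(1)] k by simp
      have "\<bar>F (?v(k := x k)) - F (?v(k := y k))\<bar> \<le> \<gamma> {k} * \<bar>x k - y k\<bar>"
      proof (rule derivative_bound_diff[where l = "a k" and r = "b k"])
        show "((\<lambda>t. F (?v(k := t))) has_vector_derivative partial_deriv a b k F (?v(k := t))) (at t within {a k..b k})"
          if "t \<in> {a k..b k}" for t
          by (rule has_partial_deriv_has_vector_derivative[OF pd mem k(1) that])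
        show "\<bar>partial_deriv a b k F (?v(k := t))\<bar> \<le> \<gamma> {k}" if "t \<in> {a k..b k}" for t
          by (intro bd box_on_upd mem k that)
      qed (use box_on_mem[OF x k(1)] box_on_mem[OF y k(1)] in auto)
      moreover have "?v(k := x k) = ?v" "?v(k := y k) = (\<lambda>i. if i \<in> insert k A then y i else x i)"
        using k by auto
      ultimately have "\<bar>F ?v - F (\<lambda>i. if i \<in> insert k A then y i else x i)\<bar> \<le> \<gamma> {k} * \<bar>x k - y k\<bar>"
        by (simp only:)
      moreover have "\<bar>F x - F ?v\<bar> \<le> (\<Sum>i\<in>A. \<gamma> {i} * \<bar>x i - y i\<bar>)" using insert by auto
      moreover have "(\<Sum>i\<in>insert k A. \<gamma> {i} * \<bar>x i - y i\<bar>) = \<gamma> {k} * \<bar>x k - y k\<bar> + (\<Sum>i\<in>A. \<gamma> {i} * \<bar>x i - y i\<bar>)"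
        using insert by simp
      ultimately show ?case by linarith
    qed simp
  qed
  from this[of "{1..s}"] moreover have "(\<lambda>i. if i \<in> {1..s} then y i else x i) = y"
    using x y by (auto simp: box_on_def PiE_iff extensional_def)
  ultimately show ?thesis by simp
qed

text \<open>The projection onto the box. Composed with it, \<open>F\<close> becomes a Lipschitz
  function on the whole space, independent of the arbitrary values that \<open>F\<close> takes off
  the box.\<close>

definition clamp_box :: "(nat \<Rightarrow> real) \<Rightarrow> (nat \<Rightarrow> real) \<Rightarrow> nat \<Rightarrow> (nat \<Rightarrow> real) \<Rightarrow> nat \<Rightarrow> real" where
  "clamp_box a b s x = (\<lambda>i\<in>{1..s}. max (a i) (min (b i) (x i)))"

lemma clamp_box_mem:
  assumes "\<And>i. i \<in> {1..s} \<Longrightarrow> a i \<le> b i"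
  shows "clamp_box a b s x \<in> box_on a b s"
  using assms by (auto simp: clamp_box_def box_on_def)

lemma clamp_box_id: "x \<in> box_on a b s \<Longrightarrow> clamp_box a b s x = x"
  by (rule ext) (auto simp: clamp_box_def box_on_def PiE_iff extensional_def)

lemma unit_ball_clamp_measurable:
  assumes F: "F \<in> unit_ball a b \<gamma> s" and \<gamma>: "\<And>i. i \<in> {1..s} \<Longrightarrow> \<gamma> {i} > 0"
    and ab: "\<And>i. i \<in> {1..s} \<Longrightarrow> a i \<le> b i"
  shows "(\<lambda>x. F (clamp_box a b s x)) \<in> borel_measurable (\<Pi>\<^sub>M i\<in>{1..s}. lebesgue)"
proof -
  let ?H = "\<lambda>x. F (clamp_box a b s x)"
  have lip: "\<bar>?H x - ?H y\<bar> \<le> (\<Sum>i\<in>{1..s}. \<gamma> {i} * \<bar>x i - y i\<bar>)" for x y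
  proof -
    have "\<bar>?H x - ?H y\<bar> \<le> (\<Sum>i\<in>{1..s}. \<gamma> {i} * \<bar>clamp_box a b s x i - clamp_box a b s y i\<bar>)"
      by (intro unit_ball_lipschitz[OF F \<gamma>] clamp_box_mem ab) auto
    also have "\<dots> \<le> (\<Sum>i\<in>{1..s}. \<gamma> {i} * \<bar>x i - y i\<bar>)"
      using \<gamma> by (intro sum_mono mult_left_mono) (auto simp: clamp_box_def less_imp_le)
    finally show ?thesis .
  qed
  \<comment> \<open>The Lipschitz bound involves finitely many coordinates, so it gives continuity
    in the product topology on \<open>nat \<Rightarrow> real\<close>.\<close>
  have "continuous_on UNIV ?H"
    unfolding continuous_on_def
  proof
    fix y :: "nat \<Rightarrow> real"
    have coord: "((\<lambda>x. x i) \<longlongrightarrow> y i) (at y)" for i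
      using continuous_on_product_coordinates[of i] unfolding continuous_on_def by blast
    have "((\<lambda>x. \<Sum>i\<in>{1..s}. \<gamma> {i} * \<bar>x i - y i\<bar>) \<longlongrightarrow> (\<Sum>i\<in>{1..s}. \<gamma> {i} * \<bar>y i - y i\<bar>)) (at y)"
      by (intro tendsto_intros coord)
    then have "((\<lambda>x. \<Sum>i\<in>{1..s}. \<gamma> {i} * \<bar>x i - y i\<bar>) \<longlongrightarrow> 0) (at y)" by simp
    then have "((\<lambda>x. ?H x - ?H y) \<longlongrightarrow> 0) (at y)"
      by (rule Lim_null_comparison[rotated]) (simp only: real_norm_def lip eventually_True)
    then show "(?H \<longlongrightarrow> ?H y) (at y)" by (rule LIM_zero_cancel)
  qed
  then have "?H \<in> borel_measurable borel" by (rule borel_measurable_continuous_onI)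
  \<comment> \<open>Passes from the finite product of Lebesgue spaces to the Borel space of all
    sequences; the value 0 in the remaining coordinates is ignored by
    \<open>clamp_box\<close>.\<close>
  moreover have "(\<lambda>x i. if i \<in> {1..s} then x i else 0) \<in> borel_measurable (\<Pi>\<^sub>M i\<in>{1..s}. lebesgue :: real measure)"
  proof (rule measurable_coordinatewise_then_product)
    fix i
    have "(\<lambda>x. x i) \<in> borel_measurable (\<Pi>\<^sub>M i\<in>{1..s}. lebesgue :: real measure)" if "i \<in> {1..s}"
      by (rule measurable_compose[OF measurable_component_singleton[OF that] measurable_completion]) simp
    then show "(\<lambda>x. if i \<in> {1..s} then x i else 0) \<in> borel_measurable (\<Pi>\<^sub>M i\<in>{1..s}. lebesgue :: real measure)"
      by (cases "i \<in> {1..s}") auto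
  qed
  ultimately have "(\<lambda>x. ?H (\<lambda>i. if i \<in> {1..s} then x i else 0)) \<in> borel_measurable (\<Pi>\<^sub>M i\<in>{1..s}. lebesgue)"
    by (rule measurable_compose[rotated])
  moreover have "clamp_box a b s (\<lambda>i. if i \<in> {1..s} then x i else 0) = clamp_box a b s x" for x
    by (auto simp: clamp_box_def)
  ultimately show ?thesis by simp
qed

section \<open>Quantiles, cells of equal mass and the Riemann sum\<close>

locale box_densities =
  fixes a b :: "nat \<Rightarrow> real" and \<phi> :: "nat \<Rightarrow> real \<Rightarrow> real"
  assumes a_less_b: "\<And>i. i \<ge> 1 \<Longrightarrow> a i < b i"
    and density: "\<And>i. i \<ge> 1 \<Longrightarrow> prob_density_on (a i) (b i) (\<phi> i)"
    and distr_bij: "\<And>i. i \<ge> 1 \<Longrightarrow> bij_betw (distr_fun a \<phi> i) {a i..b i} {0..1}"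
begin

definition quantile :: "nat \<Rightarrow> real \<Rightarrow> real" where
  "quantile i = the_inv_into {a i..b i} (distr_fun a \<phi> i)"

lemma distr_fun_mono:
  assumes "i \<ge> 1" "x \<in> {a i..b i}" "y \<in> {a i..b i}" "x \<le> y"
  shows "distr_fun a \<phi> i x \<le> distr_fun a \<phi> i y"
proof -
  note d = density[OF assms(1), unfolded prob_density_on_def]
  have int: "set_integrable lebesgue {a i..t} (\<phi> i)" if "t \<in> {a i..b i}" for t
  proof (rule set_integrable_subset)
    show "set_integrable lebesgue {a i..b i} (\<phi> i)" using d by blast
  qed (use that in auto)
  show ?thesis
    unfolding distr_fun_def set_lebesgue_integral_def
    using int[OF assms(2)] int[OF assms(3)] d assms
    by (intro integral_mono) (auto simp: set_integrable_def indicator_def)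
qed

lemma quantile_mem: "i \<ge> 1 \<Longrightarrow> t \<in> {0..1} \<Longrightarrow> quantile i t \<in> {a i..b i}"
  using distr_bij[of i] unfolding quantile_def bij_betw_def
  by (intro the_inv_into_into) auto

lemma distr_fun_quantile: "i \<ge> 1 \<Longrightarrow> t \<in> {0..1} \<Longrightarrow> distr_fun a \<phi> i (quantile i t) = t"
  using distr_bij[of i] unfolding quantile_def by (intro f_the_inv_into_f_bij_betw) auto

lemma quantile_mono:
  assumes "i \<ge> 1" "t \<in> {0..1}" "t' \<in> {0..1}" "t \<le> t'"
  shows "quantile i t \<le> quantile i t'"
proof (rule ccontr)
  assume "\<not> quantile i t \<le> quantile i t'"
  then have le: "quantile i t' \<le> quantile i t" "quantile i t' \<noteq> quantile i t" by auto
  have "distr_fun a \<phi> i (quantile i t') \<le> distr_fun a \<phi> i (quantile i t)"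
    using assms le(1) by (intro distr_fun_mono quantile_mem)
  then have "t' \<le> t" using assms by (simp only: distr_fun_quantile)
  then have "t' = t" using assms(4) by simp
  then show False using le(2) by simp
qed

lemma quantile_eqI: "i \<ge> 1 \<Longrightarrow> x \<in> {a i..b i} \<Longrightarrow> quantile i (distr_fun a \<phi> i x) = x"
  using distr_bij[of i] unfolding quantile_def bij_betw_def by (intro the_inv_into_f_f) auto

lemma quantile_0: "i \<ge> 1 \<Longrightarrow> quantile i 0 = a i"
proof -
  assume i: "i \<ge> 1"
  have "distr_fun a \<phi> i (a i) = 0"
    unfolding distr_fun_def set_lebesgue_integral_def
  proof (rule integral_eq_zero_AE)
    have "AE x in lebesgue. x \<noteq> a i" by (rule AE_completion[OF AE_lborel_singleton])
    then show "AE x in lebesgue. indicat_real {a i..a i} x *\<^sub>R \<phi> i x = 0"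
      by eventually_elim simp
  qed
  then show ?thesis using quantile_eqI[OF i, of "a i"] a_less_b[OF i] by simp
qed

lemma quantile_1: "i \<ge> 1 \<Longrightarrow> quantile i 1 = b i"
  using quantile_eqI[of i "b i"] density[of i] a_less_b[of i]
  by (simp add: distr_fun_def prob_density_on_def)

text \<open>The preimage of the \<open>j\<close>-th interval of length \<open>1/N\<close>; the first one also contains its left
  endpoint, so that the cells partition \<open>{a i..b i}\<close>.\<close>

definition cell :: "nat \<Rightarrow> nat \<Rightarrow> nat \<Rightarrow> real set" where
  "cell N i j = (if j = 0 then {a i..quantile i (1 / real N)}
    else {quantile i (real j / real N)<..quantile i (real (Suc j) / real N)})"

definition cell_density :: "nat \<Rightarrow> nat \<Rightarrow> nat \<Rightarrow> real \<Rightarrow> real" where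
  "cell_density N i j t = indicator (cell N i j) t * \<phi> i t"

lemma grid_unit: "j \<le> N \<Longrightarrow> real j / real N \<in> {0..1}"
  by (auto simp: divide_le_eq_1)

lemma cell_subset: "i \<ge> 1 \<Longrightarrow> j < N \<Longrightarrow> cell N i j \<subseteq> {quantile i (real j / real N)..quantile i (real (Suc j) / real N)}"
  by (cases "j = 0") (auto simp: cell_def quantile_0)

lemma sum_cell_indicator:
  assumes "i \<ge> 1" "n < N"
  shows "(\<Sum>j<Suc n. indicator (cell N i j) t) = (indicator {a i..quantile i (real (Suc n) / real N)} t :: real)"
  using assms(2)
proof (induction n)
  case (Suc n)
  have "quantile i (real (Suc n) / real N) \<le> quantile i (real (Suc (Suc n)) / real N)"
    using Suc.prems assms(1) by (intro quantile_mono grid_unit divide_right_mono) auto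
  moreover have "a i \<le> quantile i (real (Suc n) / real N)"
    using quantile_mem[OF assms(1) grid_unit[of "Suc n" N]] Suc.prems by simp
  ultimately show ?case using Suc unfolding sum.lessThan_Suc[of _ "Suc n"]
    by (auto simp: cell_def indicator_def simp del: of_nat_Suc sum.lessThan_Suc)
qed (simp add: cell_def)

lemma sum_cell_density:
  assumes "i \<ge> 1" "N > 0"
  shows "(\<Sum>j<N. cell_density N i j t) = indicator {a i..b i} t * \<phi> i t"
proof -
  obtain n where "N = Suc n" using assms(2) by (metis gr0_implies_Suc)
  then show ?thesis
    using sum_cell_indicator[OF assms(1), of n N t] quantile_1[OF assms(1)]
    by (simp add: cell_density_def sum_distrib_right[symmetric] del: of_nat_Suc sum.lessThan_Suc)
qed

lemma cell_density_nonneg: "i \<ge> 1 \<Longrightarrow> j < N \<Longrightarrow> 0 \<le> cell_density N i j t"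
  using cell_subset[of i j N] quantile_mem[OF _ grid_unit[of j N], of i]
    quantile_mem[OF _ grid_unit[of "Suc j" N], of i] density[of i]
  unfolding cell_density_def prob_density_on_def indicator_def by (force simp del: of_nat_Suc)

text \<open>A cell is a difference of two initial intervals whose masses are consecutive multiples
  of 1/N; the first cell is itself an initial interval.\<close>

lemma cell_density_integral:
  assumes i: "i \<ge> 1" and j: "j < N"
  shows "integrable lebesgue (cell_density N i j)" "integral\<^sup>L lebesgue (cell_density N i j) = 1 / real N"
proof -
  define \<Phi> where "\<Phi> = (\<lambda>r t. indicator {a i..r} t * \<phi> i t)"
  have int: "integrable lebesgue (\<Phi> r)" if "r \<in> {a i..b i}" for r
    using set_integrable_subset[of lebesgue "{a i..b i}" "\<phi> i" "{a i..r}"] density[OF i] that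
    by (simp add: set_integrable_def prob_density_on_def \<Phi>_def)
  have val: "integral\<^sup>L lebesgue (\<Phi> (quantile i t)) = t" if "t \<in> {0..1}" for t
    using distr_fun_quantile[OF i that] by (simp add: distr_fun_def set_lebesgue_integral_def \<Phi>_def)
  have q: "quantile i (real k / real N) \<in> {a i..b i}" if "k \<le> N" for k
    by (intro quantile_mem grid_unit i that)
  have mono: "quantile i (real j / real N) \<le> quantile i (real (Suc j) / real N)"
    using i j by (intro quantile_mono grid_unit divide_right_mono) auto
  have "integrable lebesgue (cell_density N i j) \<and> integral\<^sup>L lebesgue (cell_density N i j) = 1 / real N"
  proof (cases "j = 0")
    case True
    then have "cell_density N i j = \<Phi> (quantile i (real 1 / real N))"
      by (simp add: fun_eq_iff cell_density_def cell_def \<Phi>_def)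
    then show ?thesis using int[OF q[of 1]] val[OF grid_unit[of 1 N]] j by simp
  next
    case False
    have "cell_density N i j = (\<lambda>t. \<Phi> (quantile i (real (Suc j) / real N)) t - \<Phi> (quantile i (real j / real N)) t)"
      using False mono q[of j] j by (auto simp: fun_eq_iff cell_density_def cell_def \<Phi>_def indicator_def simp del: of_nat_Suc)
    then show ?thesis
      using int[OF q[of j]] int[OF q[of "Suc j"]] val[OF grid_unit[of j N]] val[OF grid_unit[of "Suc j" N]] j
      by (simp add: diff_divide_distrib[symmetric])
  qed
  then show "integrable lebesgue (cell_density N i j)" "integral\<^sup>L lebesgue (cell_density N i j) = 1 / real N" by auto
qed

text \<open>Each side is partitioned into cells, so the product density splits into a sum over grid
  indices. Off the box both sides vanish, which is why \<open>F\<close> may be clamped.\<close>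

lemma unit_ball_integral_eq:
  assumes F: "F \<in> unit_ball a b \<gamma> s" and N: "N > 0"
  shows "(LINT x:box_on a b s|(\<Pi>\<^sub>M i\<in>{1..s}. lebesgue). F x * (\<Prod>i\<in>{1..s}. \<phi> i (x i))) =
    (LINT x|(\<Pi>\<^sub>M i\<in>{1..s}. lebesgue). (\<Sum>j\<in>(\<Pi>\<^sub>E i\<in>{1..s}. {..<N}).
      F (clamp_box a b s x) * (\<Prod>i\<in>{1..s}. cell_density N i (j i) (x i))))"
  unfolding set_lebesgue_integral_def
proof (rule Bochner_Integration.integral_cong[OF refl])
  fix x assume "x \<in> space (\<Pi>\<^sub>M i\<in>{1..s}. lebesgue :: real measure)"
  then have ext: "x \<in> extensional {1..s}" by (simp add: space_PiM PiE_iff)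
  have "(\<Sum>j\<in>(\<Pi>\<^sub>E i\<in>{1..s}. {..<N}). F (clamp_box a b s x) * (\<Prod>i\<in>{1..s}. cell_density N i (j i) (x i))) =
      F (clamp_box a b s x) * (\<Prod>i\<in>{1..s}. \<Sum>j<N. cell_density N i j (x i))"
    by (subst prod_sum_PiE) (simp_all add: sum_distrib_left)
  also have "\<dots> = F (clamp_box a b s x) * (\<Prod>i\<in>{1..s}. indicator {a i..b i} (x i) * \<phi> i (x i))"
    using N by (intro arg_cong2[where f = "(*)"] prod.cong refl) (simp add: sum_cell_density)
  also have "\<dots> = indicator (box_on a b s) x *\<^sub>R (F x * (\<Prod>i\<in>{1..s}. \<phi> i (x i)))"
  proof (cases "x \<in> box_on a b s")
    case True
    then have "x i \<in> {a i..b i}" if "i \<in> {1..s}" for i using that by (rule box_on_mem)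
    then show ?thesis using True by (simp add: clamp_box_id)
  next
    case False
    then obtain i where "i \<in> {1..s}" "x i \<notin> {a i..b i}" using ext by (auto simp: box_on_def PiE_iff)
    then have "(\<Prod>i\<in>{1..s}. indicator {a i..b i} (x i) * \<phi> i (x i)) = 0" by (intro prod_zero bexI[of _ i]) auto
    then show ?thesis using False by simp
  qed
  finally show "indicator (box_on a b s) x *\<^sub>R (F x * (\<Prod>i\<in>{1..s}. \<phi> i (x i))) =
      (\<Sum>j\<in>(\<Pi>\<^sub>E i\<in>{1..s}. {..<N}). F (clamp_box a b s x) * (\<Prod>i\<in>{1..s}. cell_density N i (j i) (x i)))" ..
qed

text \<open>On a product of cells \<open>F\<close> deviates from its value at the lower corner by at
  most the weighted side lengths. Averaged over the grid, the side lengths in direction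
  \<open>i\<close> telescope to (b i - a i) / N.\<close>

lemma unit_ball_quadrature_bound:
  assumes F: "F \<in> unit_ball a b \<gamma> s" and \<gamma>: "\<And>i. i \<in> {1..s} \<Longrightarrow> \<gamma> {i} > 0" "\<gamma> {} > 0" and N: "N > 0"
  shows "\<bar>(\<Sum>j\<in>(\<Pi>\<^sub>E i\<in>{1..s}. {..<N}). F (\<lambda>i\<in>{1..s}. quantile i (real (j i) / real N)) * (\<Prod>i\<in>{1..s}. 1 / real N))
      - (LINT x:box_on a b s|(\<Pi>\<^sub>M i\<in>{1..s}. lebesgue). F x * (\<Prod>i\<in>{1..s}. \<phi> i (x i)))\<bar>
    \<le> (\<Sum>i\<in>{1..s}. \<gamma> {i} * (b i - a i)) / real N"
proof -
  let ?M = "\<Pi>\<^sub>M i\<in>{1..s}. lebesgue :: real measure" and ?J = "\<Pi>\<^sub>E i\<in>{1..s}. {..<N}"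
  define P where "P = (\<lambda>j x. \<Prod>i\<in>{1..s}. cell_density N i (j i) (x i))"
  define G where "G = (\<lambda>j. F (\<lambda>i\<in>{1..s}. quantile i (real (j i) / real N)))"
  define H where "H = (\<lambda>x. F (clamp_box a b s x))"
  define len where "len = (\<lambda>i j. quantile i (real (Suc j) / real N) - quantile i (real j / real N))"
  define D where "D = (\<lambda>j. \<Sum>i\<in>{1..s}. \<gamma> {i} * len i (j i))"
  have ab: "a i \<le> b i" if "i \<in> {1..s}" for i using that a_less_b[of i] by simp
  have J: "j i < N" if "j \<in> ?J" "i \<in> {1..s}" for i j using PiE_mem[OF that] by simp
  have P: "integrable ?M (P j)" "integral\<^sup>L ?M (P j) = (\<Prod>i\<in>{1..s}. 1 / real N)" if "j \<in> ?J" for j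
  proof -
    have "integrable lebesgue (cell_density N i (j i))" if "i \<in> {1..s}" for i
      using cell_density_integral(1)[of i "j i" N] J[OF \<open>j \<in> ?J\<close> that] that by auto
    moreover have "integral\<^sup>L lebesgue (cell_density N i (j i)) = 1 / real N" if "i \<in> {1..s}" for i
      using cell_density_integral(2)[of i "j i" N] J[OF \<open>j \<in> ?J\<close> that] that by auto
    moreover from this have "(\<Prod>i\<in>{1..s}. integral\<^sup>L lebesgue (cell_density N i (j i))) = (\<Prod>i\<in>{1..s}. 1 / real N)"
      by (intro prod.cong refl)
    ultimately show "integrable ?M (P j)" "integral\<^sup>L ?M (P j) = (\<Prod>i\<in>{1..s}. 1 / real N)"
      unfolding P_def
      using lebesgue_product.product_integrable_prod[of "{1..s}" "\<lambda>i. cell_density N i (j i)"]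
        lebesgue_product.product_integral_prod[of "{1..s}" "\<lambda>i. cell_density N i (j i)"]
      by simp_all
  qed
  have P0: "0 \<le> P j x" if "j \<in> ?J" for j x
    unfolding P_def using J[OF that] by (intro prod_nonneg ballI cell_density_nonneg) auto
  have HP: "integrable ?M (\<lambda>x. H x * P j x)" if "j \<in> ?J" for j
  proof (rule Bochner_Integration.integrable_bound[OF integrable_mult_right[OF P(1)[OF that], of "\<gamma> {}"]])
    have "H \<in> borel_measurable ?M"
      unfolding H_def using F \<gamma>(1) ab by (intro unit_ball_clamp_measurable) auto
    then show "(\<lambda>x. H x * P j x) \<in> borel_measurable ?M"
      using P(1)[OF that] by (intro borel_measurable_times) auto
    have "\<bar>H x\<bar> \<le> \<gamma> {}" for x
      unfolding H_def by (rule unit_ball_abs_le[where \<gamma> = \<gamma>, OF F \<gamma>(2) clamp_box_mem[OF ab]])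
    then show "AE x in ?M. norm (H x * P j x) \<le> norm (\<gamma> {} * P j x)"
      using \<gamma>(2) P0[OF that] by (intro AE_I2) (simp add: abs_mult mult_right_mono)
  qed
  \<comment> \<open>Where \<open>P j x\<close> is nonzero, \<open>x\<close> lies in the product of
    cells with index \<open>j\<close>, hence in the box, where clamping has no effect.\<close>
  have diff: "\<bar>(H x - G j) * P j x\<bar> \<le> D j * P j x" if j: "j \<in> ?J" for j x
  proof (cases "P j x = 0")
    case False
    have cell: "x i \<in> cell N i (j i)" if "i \<in> {1..s}" for i
    proof (rule ccontr)
      assume "x i \<notin> cell N i (j i)"
      then have "P j x = 0" unfolding P_def using that
        by (intro prod_zero bexI[of _ i]) (auto simp: cell_density_def)
      then show False using False by simp
    qed
    have between: "quantile i (real (j i) / real N) \<le> x i" "x i \<le> quantile i (real (Suc (j i)) / real N)"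
      "x i \<in> {a i..b i}" if "i \<in> {1..s}" for i
    proof -
      have "i \<ge> 1" "j i < N" using that J[OF j that] by auto
      then show bd: "quantile i (real (j i) / real N) \<le> x i" "x i \<le> quantile i (real (Suc (j i)) / real N)"
        using cell_subset[of i "j i" N] cell[OF that] by auto
      show "x i \<in> {a i..b i}"
        using bd quantile_mem[OF \<open>i \<ge> 1\<close> grid_unit[of "j i" N]]
          quantile_mem[OF \<open>i \<ge> 1\<close> grid_unit[of "Suc (j i)" N]] \<open>j i < N\<close> by auto
    qed
    have mem: "(\<lambda>i\<in>{1..s}. quantile i (real (j i) / real N)) \<in> box_on a b s"
    proof -
      have "quantile i (real (j i) / real N) \<in> {a i..b i}" if "i \<in> {1..s}" for i
        using that J[OF j that] by (intro quantile_mem grid_unit) auto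
      then show ?thesis by (auto simp: box_on_def)
    qed
    have "\<bar>H x - G j\<bar> \<le> (\<Sum>i\<in>{1..s}. \<gamma> {i} * \<bar>clamp_box a b s x i - (\<lambda>i\<in>{1..s}. quantile i (real (j i) / real N)) i\<bar>)"
      unfolding H_def G_def by (rule unit_ball_lipschitz[where \<gamma> = \<gamma>, OF F \<gamma>(1) clamp_box_mem[OF ab] mem])
    also have "\<dots> \<le> D j"
      unfolding D_def
    proof (intro sum_mono mult_left_mono)
      fix i assume i: "i \<in> {1..s}"
      show "\<bar>clamp_box a b s x i - (\<lambda>i\<in>{1..s}. quantile i (real (j i) / real N)) i\<bar> \<le> len i (j i)"
        using between[OF i] i by (simp add: clamp_box_def len_def)
      show "0 \<le> \<gamma> {i}" using \<gamma>(1)[OF i] by simp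
    qed
    finally show ?thesis using P0[OF j] by (simp add: abs_mult mult_right_mono)
  qed simp
  have "(\<Sum>j\<in>?J. G j * (\<Prod>i\<in>{1..s}. 1 / real N)) - (LINT x:box_on a b s|?M. F x * (\<Prod>i\<in>{1..s}. \<phi> i (x i))) =
      (\<Sum>j\<in>?J. G j * integral\<^sup>L ?M (P j)) - (\<Sum>j\<in>?J. LINT x|?M. H x * P j x)"
    unfolding unit_ball_integral_eq[OF F N] using HP P(2) by (simp add: H_def P_def Bochner_Integration.integral_sum)
  also have "\<dots> = (\<Sum>j\<in>?J. - (LINT x|?M. (H x - G j) * P j x))"
    using HP P(1) by (simp add: sum_subtractf[symmetric] left_diff_distrib cong: sum.cong)
  also have "\<bar>\<dots>\<bar> \<le> (\<Sum>j\<in>?J. D j * (\<Prod>i\<in>{1..s}. 1 / real N))"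
  proof (rule order_trans[OF sum_abs sum_mono])
    fix j assume j: "j \<in> ?J"
    have "integrable ?M (\<lambda>x. (H x - G j) * P j x)"
      using HP[OF j] P(1)[OF j] by (simp add: left_diff_distrib)
    then have "\<bar>LINT x|?M. (H x - G j) * P j x\<bar> \<le> (LINT x|?M. D j * P j x)"
      using diff[OF j] P(1)[OF j] by (intro order_trans[OF integral_abs_bound integral_mono]) auto
    then show "\<bar>- (LINT x|?M. (H x - G j) * P j x)\<bar> \<le> D j * (\<Prod>i\<in>{1..s}. 1 / real N)"
      using P(2)[OF j] by simp
  qed
  also have "\<dots> = (\<Sum>i\<in>{1..s}. \<gamma> {i} * (\<Sum>j\<in>?J. len i (j i) * (\<Prod>i\<in>{1..s}. 1 / real N)))"
    unfolding D_def sum_distrib_right sum_distrib_left by (subst sum.swap) (simp add: mult.assoc)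
  also have "\<dots> = (\<Sum>i\<in>{1..s}. \<gamma> {i} * ((b i - a i) / real N))"
  proof (rule sum.cong[OF refl])
    fix i assume i: "i \<in> {1..s}"
    have "(\<Sum>j<N. len i j) = b i - a i"
      unfolding len_def sum_lessThan_telescope[of "\<lambda>j. quantile i (real j / real N)" N]
      using i N by (simp add: quantile_0 quantile_1)
    then show "\<gamma> {i} * (\<Sum>j\<in>?J. len i (j i) * (\<Prod>i\<in>{1..s}. 1 / real N)) = \<gamma> {i} * ((b i - a i) / real N)"
      using sum_PiE_coord[of "{1..s}" i N "len i"] i N by simp
  qed
  finally show ?thesis by (simp add: G_def sum_divide_distrib)
qed

end

subsection \<open>Error bounds\<close>

context box_densities
begin

text \<open>Coordinates in \<open>u\<close> contribute the oscillation estimate by summation by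
  parts, the others are averaged; the mixed derivative is at most \<gamma> u on the unit
  ball.\<close>

lemma grid_coeff_bound:
  assumes F: "F \<in> unit_ball a b \<gamma> s" and u: "u \<subseteq> {1..s}" and \<gamma>: "\<gamma> u > 0"
    and k: "k \<in> (\<Pi>\<^sub>E i\<in>u. {1..2 ^ m - 1})"
  shows "\<bar>grid_coeff m s (\<lambda>j. F (\<lambda>i\<in>{1..s}. quantile i (real (j i) / 2 ^ m))) u k\<bar>
    \<le> (\<Prod>i\<in>u. (b i - a i) / 2 ^ mu (k i)) * \<gamma> u"
  unfolding grid_coeff_def
proof (rule grid_sum_mixed_partial_bound[where a = a and b = b and z = "\<lambda>i j. quantile i (real j / 2 ^ m)"
      and w = "walsh_weight m u k", OF u])
  have unit: "real j / 2 ^ m \<in> {0..1}" if "j \<le> 2 ^ m" for j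
    using grid_unit[OF that] by simp
  show "a i \<le> b i" if "i \<in> {1..s}" for i using that a_less_b[of i] by simp
  show "has_mixed_partial a b s (sorted_list_of_set u) F"
    by (rule unit_ball_mixed_partial(1)[where \<gamma> = \<gamma>, OF F u \<gamma>])
  show "\<bar>mixed_partial a b (sorted_list_of_set u) F x\<bar> \<le> \<gamma> u" if "x \<in> box_on a b s" for x
    by (rule unit_ball_mixed_partial(2)[where \<gamma> = \<gamma>, OF F u \<gamma> that])
  show q: "quantile i (real j / 2 ^ m) \<in> {a i..b i}" if "i \<in> {1..s}" "j < 2 ^ m" for i j
    using that by (intro quantile_mem unit) auto
  show "(\<Sum>j<2 ^ m. \<bar>walsh_weight m u k i j\<bar>) \<le> 1" if "i \<in> {1..s} - u" for i
    using that by (simp add: walsh_weight_def)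
  fix i and h h' :: "real \<Rightarrow> real" and M :: real
  assume i: "i \<in> u"
    and h: "\<And>t. t \<in> {a i..b i} \<Longrightarrow> (h has_vector_derivative h' t) (at t within {a i..b i})"
    and M: "\<And>t. t \<in> {a i..b i} \<Longrightarrow> \<bar>h' t\<bar> \<le> M"
  have i1: "i \<in> {1..s}" using i u by auto
  have "k i \<in> {1..2 ^ m - 1}" using k i by (rule PiE_mem)
  moreover have "(0::nat) < 2 ^ m" by simp
  ultimately have ki: "1 \<le> k i" "k i < 2 ^ m" by auto
  have w: "(\<Sum>j<J. walsh_weight m u k i j) = (\<Sum>j<J. wal (k i) (real j / 2 ^ m)) / 2 ^ m" for J
    using i by (simp add: walsh_weight_def sum_divide_distrib)
  have "\<bar>\<Sum>j<2 ^ m. walsh_weight m u k i j * h (quantile i (real j / 2 ^ m))\<bar> \<le> 1 / 2 ^ mu (k i) * (b i - a i) * M"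
  proof (rule weighted_sum_derivative_bound[OF h M])
    show "quantile i (real j / 2 ^ m) \<in> {a i..b i}" if "j < 2 ^ m" for j by (rule q[OF i1 that])
    show "quantile i (real j / 2 ^ m) \<le> quantile i (real (Suc j) / 2 ^ m)" if "Suc j < 2 ^ m" for j
      using that i1 by (intro quantile_mono unit divide_right_mono) auto
    show "(\<Sum>j<2 ^ m. walsh_weight m u k i j) = 0"
      unfolding w wal_partial_sums(1)[OF ki] by simp
    show "\<bar>\<Sum>j<J. walsh_weight m u k i j\<bar> \<le> 1 / 2 ^ mu (k i)" if "J \<le> 2 ^ m" for J
      using wal_partial_sums(2)[OF ki that] unfolding w by (simp add: abs_divide field_simps)
    show "(0::nat) < 2 ^ m" by simp
  qed
  then show "\<bar>\<Sum>j<2 ^ m. walsh_weight m u k i j * h (quantile i (real j / 2 ^ m))\<bar> \<le> (b i - a i) / 2 ^ mu (k i) * M"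
    by simp
qed

lemma wce_le_merit:
  assumes \<gamma>: "\<And>u. finite u \<Longrightarrow> u \<subseteq> {1..} \<Longrightarrow> \<gamma> u > 0"
    and size: "size P = 2 ^ m"
    and grid: "\<And>y i. y \<in># P \<Longrightarrow> i \<in> {1..s} \<Longrightarrow> \<exists>p<2 ^ m. y i = real p / 2 ^ m"
  shows "wce P a b s \<gamma> \<phi> \<le> ereal ((\<Sum>i\<in>{1..s}. \<gamma> {i} * (b i - a i)) / 2 ^ m +
    (\<Sum>u\<in>Pow {1..s} - {{}}. \<gamma> u * (\<Prod>i\<in>u. b i - a i) * merit_E m P u))"
  unfolding wce_def
proof (rule SUP_least)
  fix F assume F: "F \<in> unit_ball a b \<gamma> s"
  let ?I = "LINT x:box_on a b s|(\<Pi>\<^sub>M i\<in>{1..s}. lebesgue). F x * (\<Prod>i\<in>{1..s}. \<phi> i (x i))"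
  let ?K = "\<lambda>u. \<Pi>\<^sub>E i\<in>u. {1..2 ^ m - 1::nat}"
  define G where "G = (\<lambda>j. F (\<lambda>i\<in>{1..s}. quantile i (real (j i) / 2 ^ m)))"
  define W where "W = (\<lambda>u k. 1 / 2 ^ m * (\<Sum>y\<in>#P. \<Prod>i\<in>u. wal (k i) (y i)))"
  have \<gamma>u: "\<gamma> u > 0" if "u \<subseteq> {1..s}" for u
    using that finite_subset[OF that] by (intro \<gamma>) auto
  have sample: "F (inv_distr a b \<phi> s y) =
      (\<Sum>u\<in>Pow {1..s}. \<Sum>k\<in>?K u. grid_coeff m s G u k * (\<Prod>i\<in>u. wal (k i) (y i)))" if y: "y \<in># P" for y
  proof -
    obtain p where p: "\<And>i. i \<in> {1..s} \<Longrightarrow> p i < 2 ^ m \<and> y i = real (p i) / 2 ^ m"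
      using grid[OF y] by metis
    have "restrict p {1..s} \<in> (\<Pi>\<^sub>E i\<in>{1..s}. {..<2 ^ m})" using p by auto
    note expansion = grid_walsh_expansion[OF this, of G]
    have G_eq: "G (restrict p {1..s}) = F (inv_distr a b \<phi> s y)"
      unfolding G_def inv_distr_def quantile_def using p by (intro arg_cong[where f = F] restrict_ext) auto
    have "(\<Prod>i\<in>u. wal (k i) (real (restrict p {1..s} i) / 2 ^ m)) = (\<Prod>i\<in>u. wal (k i) (y i))"
      if "u \<in> Pow {1..s}" for u k
      using that p by (intro prod.cong refl) auto
    then show ?thesis
      unfolding G_eq[symmetric] expansion by (intro sum.cong refl arg_cong2[where f = "(*)"])
  qed
  have "1 / real (size P) * (\<Sum>y\<in>#P. F (inv_distr a b \<phi> s y)) =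
      1 / 2 ^ m * (\<Sum>y\<in>#P. \<Sum>u\<in>Pow {1..s}. \<Sum>k\<in>?K u. grid_coeff m s G u k * (\<Prod>i\<in>u. wal (k i) (y i)))"
    using sample by (simp add: size cong: image_mset_cong)
  also have "\<dots> = (\<Sum>u\<in>Pow {1..s}. \<Sum>k\<in>?K u. grid_coeff m s G u k * W u k)"
    unfolding sum_mset_swap_sum W_def sum_mset_distrib_left[symmetric] sum_distrib_left
    by (simp only: mult.left_commute)
  \<comment> \<open>The empty set is split off because its Walsh mean is 1 and its coefficient is
    the average over the whole grid, a Riemann sum independent of the point set.\<close>
  also have "\<dots> = (\<Sum>k\<in>?K {}. grid_coeff m s G {} k * W {} k) +
      (\<Sum>u\<in>Pow {1..s} - {{}}. \<Sum>k\<in>?K u. grid_coeff m s G u k * W u k)"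
    by (rule sum.remove) auto
  also have "(\<Sum>k\<in>?K {}. grid_coeff m s G {} k * W {} k) =
      (\<Sum>j\<in>(\<Pi>\<^sub>E i\<in>{1..s}. {..<2 ^ m}). G j * (\<Prod>i\<in>{1..s}. 1 / real (2 ^ m)))"
    by (simp add: W_def size grid_coeff_def walsh_weight_def mult.commute)
  finally have split: "1 / real (size P) * (\<Sum>y\<in>#P. F (inv_distr a b \<phi> s y)) - ?I =
      ((\<Sum>j\<in>(\<Pi>\<^sub>E i\<in>{1..s}. {..<2 ^ m}). G j * (\<Prod>i\<in>{1..s}. 1 / real (2 ^ m))) - ?I) +
      (\<Sum>u\<in>Pow {1..s} - {{}}. \<Sum>k\<in>?K u. grid_coeff m s G u k * W u k)"
    by simp
  have quad: "\<bar>(\<Sum>j\<in>(\<Pi>\<^sub>E i\<in>{1..s}. {..<2 ^ m}). G j * (\<Prod>i\<in>{1..s}. 1 / real (2 ^ m))) - ?I\<bar>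
      \<le> (\<Sum>i\<in>{1..s}. \<gamma> {i} * (b i - a i)) / 2 ^ m"
    using unit_ball_quadrature_bound[where \<gamma> = \<gamma> and N = "2 ^ m", OF F] \<gamma>u by (simp add: G_def)
  have walsh: "\<bar>\<Sum>u\<in>Pow {1..s} - {{}}. \<Sum>k\<in>?K u. grid_coeff m s G u k * W u k\<bar>
      \<le> (\<Sum>u\<in>Pow {1..s} - {{}}. \<gamma> u * (\<Prod>i\<in>u. b i - a i) * merit_E m P u)"
  proof (rule order_trans[OF sum_abs sum_mono])
    fix u assume "u \<in> Pow {1..s} - {{}}"
    then have u: "u \<subseteq> {1..s}" by auto
    have "\<bar>\<Sum>k\<in>?K u. grid_coeff m s G u k * W u k\<bar> \<le>
        (\<Sum>k\<in>?K u. (\<gamma> u * (\<Prod>i\<in>u. b i - a i)) * (1 / 2 ^ (\<Sum>i\<in>u. mu (k i)) * \<bar>W u k\<bar>))"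
    proof (rule order_trans[OF sum_abs sum_mono])
      fix k assume k: "k \<in> ?K u"
      have "\<bar>grid_coeff m s G u k * W u k\<bar> \<le> ((\<Prod>i\<in>u. (b i - a i) / 2 ^ mu (k i)) * \<gamma> u) * \<bar>W u k\<bar>"
        unfolding abs_mult G_def
        by (intro mult_right_mono grid_coeff_bound[where \<gamma> = \<gamma>, OF F u \<gamma>u[OF u] k]) simp
      also have "\<dots> = (\<gamma> u * (\<Prod>i\<in>u. b i - a i)) * (1 / 2 ^ (\<Sum>i\<in>u. mu (k i)) * \<bar>W u k\<bar>)"
        by (simp add: prod_dividef power_sum)
      finally show "\<bar>grid_coeff m s G u k * W u k\<bar> \<le>
          (\<gamma> u * (\<Prod>i\<in>u. b i - a i)) * (1 / 2 ^ (\<Sum>i\<in>u. mu (k i)) * \<bar>W u k\<bar>)" .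
    qed
    also have "\<dots> = \<gamma> u * (\<Prod>i\<in>u. b i - a i) * merit_E m P u"
      by (simp only: merit_E_def W_def sum_distrib_left[symmetric])
    finally show "\<bar>\<Sum>k\<in>?K u. grid_coeff m s G u k * W u k\<bar> \<le> \<gamma> u * (\<Prod>i\<in>u. b i - a i) * merit_E m P u" .
  qed
  have "\<bar>1 / real (size P) * (\<Sum>y\<in>#P. F (inv_distr a b \<phi> s y)) - ?I\<bar> \<le>
      (\<Sum>i\<in>{1..s}. \<gamma> {i} * (b i - a i)) / 2 ^ m +
      (\<Sum>u\<in>Pow {1..s} - {{}}. \<gamma> u * (\<Prod>i\<in>u. b i - a i) * merit_E m P u)"
    unfolding split using quad walsh by linarith
  then show "ereal \<bar>1 / real (size P) * (\<Sum>y\<in>#P. F (inv_distr a b \<phi> s y)) - ?I\<bar> \<le>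
      ereal ((\<Sum>i\<in>{1..s}. \<gamma> {i} * (b i - a i)) / 2 ^ m +
        (\<Sum>u\<in>Pow {1..s} - {{}}. \<gamma> u * (\<Prod>i\<in>u. b i - a i) * merit_E m P u))"
    by simp
qed

lemma wce_cbc_bound:
  assumes \<gamma>: "\<And>u. finite u \<Longrightarrow> u \<subseteq> {1..} \<Longrightarrow> \<gamma> u > 0"
    and s: "s \<ge> 1" and irr: "irreducible f" and m: "degree f = m"
    and cbc: "cbc_constructed a b \<gamma> s g f"
  shows "wce (poly_lattice s g f) a b s \<gamma> \<phi> \<le> ereal (((\<Sum>i\<in>{1..s}. \<gamma> {i} * (b i - a i)) +
    (\<Sum>u\<in>Pow {1..s} - {{}}. \<gamma> u * (\<Prod>i\<in>u. b i - a i) * (real m / 2) ^ card u)) / 2 ^ m)"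
proof -
  let ?P = "poly_lattice s g f"
  have "wce ?P a b s \<gamma> \<phi> \<le> ereal ((\<Sum>i\<in>{1..s}. \<gamma> {i} * (b i - a i)) / 2 ^ m +
    (\<Sum>u\<in>Pow {1..s} - {{}}. \<gamma> u * (\<Prod>i\<in>u. b i - a i) * merit_E m ?P u))"
  proof (rule wce_le_merit[OF \<gamma>])
    show "size ?P = 2 ^ m" by (simp add: poly_lattice_def card_Gm m)
    show "\<exists>p<2 ^ m. y i = real p / 2 ^ m" if "y \<in># ?P" "i \<in> {1..s}" for y i
      using that by (auto simp: poly_lattice_def finite_Gm m trunc_frac_eq binary_fraction_grid)
  qed
  also have "(\<Sum>u\<in>Pow {1..s} - {{}}. \<gamma> u * (\<Prod>i\<in>u. b i - a i) * merit_E m ?P u) = merit_B a b \<gamma> s g f"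
    by (simp add: merit_B_def m)
  also have "ereal ((\<Sum>i\<in>{1..s}. \<gamma> {i} * (b i - a i)) / 2 ^ m + merit_B a b \<gamma> s g f) \<le>
    ereal (((\<Sum>i\<in>{1..s}. \<gamma> {i} * (b i - a i)) +
    (\<Sum>u\<in>Pow {1..s} - {{}}. \<gamma> u * (\<Prod>i\<in>u. b i - a i) * (real m / 2) ^ card u)) / 2 ^ m)"
    using merit_B_cbc[where a = a and b = b and \<gamma> = \<gamma>, OF a_less_b \<gamma> irr cbc s order_refl]
    by (simp add: m add_divide_distrib)
  finally show ?thesis .
qed

end

section \<open>Elementary inequalities behind the constants\<close>

lemma power_half_le_max:
  fixes \<delta> :: real
  assumes "\<delta> > 0" "k \<ge> 1"
  shows "(real m / 2) ^ k \<le> max 2 (real k / (exp 1 * \<delta> * 2 * ln 2)) ^ k * 2 powr (real m * \<delta>)"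
proof -
  define y where "y = real m * \<delta> * ln 2 / real k"
  define q where "q = real k / (exp 1 * \<delta> * 2 * ln 2)"
  have q: "q > 0" using assms by (simp add: q_def)
  \<comment> \<open>The tangent inequality is sharp at y = 1, that is at m/2 = k / (2 \<delta> ln
    2), the maximiser of x^k 2^(-2 \<delta> x); the factor \<open>exp 1\<close> in \<open>q\<close>
    comes from here.\<close>
  have "y \<le> exp (y - 1)" using exp_ge_add_one_self[of "y - 1"] by simp
  then have "y * exp 1 \<le> exp y" by (simp add: exp_diff field_simps)
  moreover have "real m / 2 = q * (y * exp 1)" using assms by (simp add: q_def y_def field_simps)
  ultimately have "real m / 2 \<le> q * exp y" using q by (simp add: mult_left_mono)
  also have "\<dots> \<le> max 2 q * exp y" by (intro mult_right_mono) auto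
  finally have "(real m / 2) ^ k \<le> (max 2 q * exp y) ^ k" by (intro power_mono) auto
  also have "\<dots> = max 2 q ^ k * exp (real k * y)" by (simp add: power_mult_distrib exp_of_nat_mult)
  also have "exp (real k * y) = 2 powr (real m * \<delta>)"
    using assms by (simp add: y_def powr_def)
  finally show ?thesis by (simp add: q_def)
qed

lemma sum_prod_Pow:
  fixes \<beta> :: "nat \<Rightarrow> real"
  assumes "finite I"
  shows "(\<Sum>u\<in>Pow I. (\<Prod>i\<in>u. \<beta> i) * x ^ card u) = (\<Prod>i\<in>I. 1 + \<beta> i * x)"
proof -
  have "(\<Prod>i\<in>I. \<beta> i * x + 1) = (\<Sum>u\<in>Pow I. (\<Prod>i\<in>u. \<beta> i * x) * (\<Prod>i\<in>I - u. 1))"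
    by (rule prod_add[OF assms])
  then show ?thesis by (simp add: prod.distrib add.commute)
qed

text \<open>Absorbs the linear quadrature error into the product: the additional 1 in the factor of
  \<open>i\<close> supplies the summand \<beta> i, as the other factors are at least 1.\<close>

lemma sum_add_prod_le:
  fixes \<beta> :: "nat \<Rightarrow> real"
  assumes "finite I" "\<And>i. i \<in> I \<Longrightarrow> 0 \<le> \<beta> i" "0 \<le> x"
  shows "(\<Sum>i\<in>I. \<beta> i) + (\<Prod>i\<in>I. 1 + \<beta> i * x) \<le> (\<Prod>i\<in>I. 1 + \<beta> i * (1 + x))"
  using assms
proof (induction I rule: finite_induct)
  case (insert k I)
  let ?P = "\<Prod>i\<in>I. 1 + \<beta> i * x" and ?Q = "\<Prod>i\<in>I. 1 + \<beta> i * (1 + x)"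
  have IH: "(\<Sum>i\<in>I. \<beta> i) + ?P \<le> ?Q" using insert by auto
  have "0 \<le> (\<Sum>i\<in>I. \<beta> i)" using insert by (intro sum_nonneg) auto
  then have "?P \<le> ?Q" using IH by simp
  moreover have "1 \<le> ?Q" using insert by (intro prod_ge_1) auto
  moreover have k: "0 \<le> \<beta> k" "0 \<le> \<beta> k * x" using insert by auto
  ultimately have "\<beta> k * x * ?P \<le> \<beta> k * x * ?Q" "\<beta> k * 1 \<le> \<beta> k * ?Q"
    by (simp_all only: mult_left_mono)
  then show ?case using insert IH by (simp add: algebra_simps)
qed simp

lemma S_term_nonneg:
  assumes ab: "\<And>i. i \<ge> 1 \<Longrightarrow> a i < b i"
    and \<gamma>: "\<And>u. finite u \<Longrightarrow> u \<subseteq> {1..} \<Longrightarrow> \<gamma> u > 0" and "i \<ge> 1"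
  shows "0 \<le> S_term a b \<gamma> i"
proof -
  have "\<gamma> {i} > 0" using assms(3) by (intro \<gamma>) auto
  also have "\<gamma> {i} \<le> (MAX v\<in>Pow {1..i - 1}. \<gamma> (v \<union> {i}) / (\<gamma>({} := 1)) v)"
    by (intro Max_ge image_eqI[of _ _ "{}"]) auto
  finally show ?thesis using ab[OF \<open>i \<ge> 1\<close>] by (simp add: S_term_def)
qed

text \<open>Elements are added in increasing order, so each ratio of consecutive weights is among
  those maximised in \<open>S_term\<close>. The ratios telescope, starting from the value 1 assigned
  to the empty set.\<close>

lemma weight_le_prod_S_term:
  assumes ab: "\<And>i. i \<ge> 1 \<Longrightarrow> a i < b i"
    and \<gamma>: "\<And>u. finite u \<Longrightarrow> u \<subseteq> {1..} \<Longrightarrow> \<gamma> u > 0"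
    and "finite u" "u \<subseteq> {1..}"
  shows "(\<gamma>({} := 1)) u * (\<Prod>i\<in>u. b i - a i) \<le> (\<Prod>i\<in>u. S_term a b \<gamma> i)"
  using \<open>finite u\<close> \<open>u \<subseteq> {1..}\<close>
proof (induction u rule: finite_linorder_max_induct)
  case (insert i A)
  let ?g = "\<gamma>({} := 1)"
  have A: "A \<subseteq> {1..i - 1}" "i \<notin> A" "i \<ge> 1" using insert by force+
  have gA: "?g A > 0" using \<gamma>[of A] insert by auto
  have "\<gamma> (A \<union> {i}) / ?g A \<le> (MAX v\<in>Pow {1..i - 1}. \<gamma> (v \<union> {i}) / ?g v)"
    using A by (intro Max_ge) auto
  then have r: "(b i - a i) * (\<gamma> (A \<union> {i}) / ?g A) \<le> S_term a b \<gamma> i"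
    unfolding S_term_def using ab[OF A(3)] by (intro mult_left_mono) auto
  have "?g (insert i A) * (\<Prod>i\<in>insert i A. b i - a i) =
      (?g A * (\<Prod>i\<in>A. b i - a i)) * ((b i - a i) * (\<gamma> (A \<union> {i}) / ?g A))"
    using gA A(2) insert.hyps(1) by (simp add: field_simps)
  also have "\<dots> \<le> (\<Prod>i\<in>A. S_term a b \<gamma> i) * S_term a b \<gamma> i"
  proof (rule mult_mono)
    show "?g A * (\<Prod>i\<in>A. b i - a i) \<le> (\<Prod>i\<in>A. S_term a b \<gamma> i)" using insert by auto
    show "0 \<le> (\<Prod>i\<in>A. S_term a b \<gamma> i)"
      using A(1) by (intro prod_nonneg ballI S_term_nonneg[OF ab \<gamma>]) auto
    have "\<gamma> (A \<union> {i}) > 0" using insert by (intro \<gamma>) auto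
    then show "0 \<le> (b i - a i) * (\<gamma> (A \<union> {i}) / ?g A)"
      using gA ab[OF A(3)] by (intro mult_nonneg_nonneg divide_nonneg_pos) auto
  qed (rule r)
  also have "\<dots> = (\<Prod>i\<in>insert i A. S_term a b \<gamma> i)"
    using A(2) insert.hyps(1) by (simp add: mult.commute)
  finally show ?case .
qed simp

text \<open>With \<open>r = S / D \<ge> 1\<close>, each of the first \<open>n\<close> factors is at most \<open>r * exp (c * \<beta> i / r)\<close>;
  the remaining ones are bounded by \<open>exp (c * \<beta> i)\<close>. Both exponents sum to at most \<open>c * D\<close>.\<close>

lemma prod_one_plus_le_power_exp:
  fixes \<beta> :: "nat \<Rightarrow> real"
  assumes \<beta>: "\<And>i. i \<ge> 1 \<Longrightarrow> 0 \<le> \<beta> i" and sm: "summable (\<lambda>i. \<beta> (i + 1))"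
    and D: "0 < D" "D \<le> (\<Sum>i. \<beta> (i + 1))" and tail: "(\<Sum>i. \<beta> (i + n + 1)) \<le> D"
    and c: "0 \<le> c"
  shows "(\<Prod>i\<in>{1..s}. 1 + \<beta> i * c) \<le> ((\<Sum>i. \<beta> (i + 1)) / D) ^ n * exp (2 * D * c)"
proof -
  define S where "S = (\<Sum>i. \<beta> (i + 1))"
  define r where "r = S / D"
  have r: "1 \<le> r" "0 < r" using D by (auto simp: r_def S_def)
  have S: "S > 0" using D by (simp add: S_def)
  have le_S: "(\<Sum>i\<in>{1..n} \<inter> {1..s}. \<beta> i) \<le> S"
  proof -
    have "(\<Sum>i\<in>{1..n} \<inter> {1..s}. \<beta> i) \<le> (\<Sum>i\<in>{1..s}. \<beta> i)" using \<beta> by (intro sum_mono2) auto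
    also have "\<dots> = (\<Sum>i<s. \<beta> (i + 1))"
      by (rule sum.reindex_bij_witness[of _ "\<lambda>i. i + 1" "\<lambda>i. i - 1"]) auto
    also have "\<dots> \<le> S" unfolding S_def using \<beta> by (intro sum_le_suminf sm) auto
    finally show ?thesis .
  qed
  have le_D: "(\<Sum>i\<in>{1..s} - {1..n}. \<beta> i) \<le> D"
  proof -
    have "(\<Sum>i\<in>{1..s} - {1..n}. \<beta> i) \<le> (\<Sum>i\<in>{n + 1..n + s}. \<beta> i)" using \<beta> by (intro sum_mono2) auto
    also have "\<dots> = (\<Sum>i<s. \<beta> (i + n + 1))"
      by (rule sum.reindex_bij_witness[of _ "\<lambda>i. i + n + 1" "\<lambda>i. i - n - 1"]) auto
    also have "\<dots> \<le> (\<Sum>i. \<beta> (i + n + 1))"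
      using \<beta> sm summable_iff_shift[of "\<lambda>i. \<beta> (i + 1)" n] by (intro sum_le_suminf) auto
    finally show ?thesis using tail by simp
  qed
  have "(\<Prod>i\<in>{1..s}. 1 + \<beta> i * c) =
      (\<Prod>i\<in>{1..s} - {1..n}. 1 + \<beta> i * c) * (\<Prod>i\<in>{1..n} \<inter> {1..s}. 1 + \<beta> i * c)"
    by (subst prod.union_disjoint[symmetric]) (auto intro!: prod.cong)
  also have "\<dots> \<le> exp (c * D) * (r ^ n * exp (c * D))"
  proof (rule mult_mono)
    have "(\<Prod>i\<in>{1..s} - {1..n}. 1 + \<beta> i * c) \<le> (\<Prod>i\<in>{1..s} - {1..n}. exp (\<beta> i * c))"
      using \<beta> c by (intro prod_mono) (auto intro!: add_nonneg_nonneg)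
    also have "\<dots> = exp (c * (\<Sum>i\<in>{1..s} - {1..n}. \<beta> i))"
      by (simp add: exp_sum[symmetric] sum_distrib_left mult.commute)
    also have "\<dots> \<le> exp (c * D)" using le_D c by (simp add: mult_left_mono)
    finally show "(\<Prod>i\<in>{1..s} - {1..n}. 1 + \<beta> i * c) \<le> exp (c * D)" .
    have "(\<Prod>i\<in>{1..n} \<inter> {1..s}. 1 + \<beta> i * c) \<le> (\<Prod>i\<in>{1..n} \<inter> {1..s}. r * exp (\<beta> i * c / r))"
    proof (rule prod_mono)
      fix i assume "i \<in> {1..n} \<inter> {1..s}"
      have "1 + \<beta> i * c \<le> r * (1 + \<beta> i * c / r)" using r by (simp add: field_simps)
      also have "\<dots> \<le> r * exp (\<beta> i * c / r)" using r by (intro mult_left_mono exp_ge_add_one_self) auto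
      finally show "0 \<le> 1 + \<beta> i * c \<and> 1 + \<beta> i * c \<le> r * exp (\<beta> i * c / r)"
        using \<beta>[of i] \<open>i \<in> _\<close> c by (auto intro!: add_nonneg_nonneg)
    qed
    also have "\<dots> = r ^ card ({1..n} \<inter> {1..s}) * exp (c / r * (\<Sum>i\<in>{1..n} \<inter> {1..s}. \<beta> i))"
      by (simp add: prod.distrib exp_sum[symmetric] sum_distrib_left sum_divide_distrib mult.commute)
    also have "\<dots> \<le> r ^ n * exp (c * D)"
    proof (rule mult_mono)
      have "card ({1..n} \<inter> {1..s}) \<le> card {1..n}" by (rule card_mono) auto
      then show "r ^ card ({1..n} \<inter> {1..s}) \<le> r ^ n" using r by (intro power_increasing) auto
      have "c / r * (\<Sum>i\<in>{1..n} \<inter> {1..s}. \<beta> i) \<le> c / r * S" using le_S c r by (intro mult_left_mono) auto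
      also have "\<dots> = c * D" using S D by (simp add: r_def)
      finally show "exp (c / r * (\<Sum>i\<in>{1..n} \<inter> {1..s}. \<beta> i)) \<le> exp (c * D)" by simp
    qed (use r in auto)
    finally show "(\<Prod>i\<in>{1..n} \<inter> {1..s}. 1 + \<beta> i * c) \<le> r ^ n * exp (c * D)" .
    show "0 \<le> (\<Prod>i\<in>{1..n} \<inter> {1..s}. 1 + \<beta> i * c)"
      using \<beta> c by (intro prod_nonneg) (auto intro!: add_nonneg_nonneg)
  qed simp
  also have "\<dots> = (S / D) ^ n * exp (2 * D * c)"
    by (simp add: r_def mult_exp_exp algebra_simps)
  finally show ?thesis by (simp add: S_def)
qed

theorem theorem8:
  fixes a b :: "nat \<Rightarrow> real"
    and \<phi> :: "nat \<Rightarrow> real \<Rightarrow> real"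
    and \<gamma> :: "nat set \<Rightarrow> real"
    and f :: "bit poly"
    and g :: "nat \<Rightarrow> bit poly"
    and s m :: nat
  assumes "\<And>i. i \<ge> 1 \<Longrightarrow> a i < b i"
    and "\<And>i. i \<ge> 1 \<Longrightarrow> prob_density_on (a i) (b i) (\<phi> i)"
    and "\<And>i. i \<ge> 1 \<Longrightarrow> bij_betw (distr_fun a \<phi> i) {a i..b i} {0..1}"
    and "\<And>u. finite u \<Longrightarrow> u \<subseteq> {1..} \<Longrightarrow> \<gamma> u > 0"
    and "s \<ge> 1"
    and "irreducible f" and "degree f = m"
    and "cbc_constructed a b \<gamma> s g f"
  shows "(\<forall>\<delta>\<in>{0<..<1}. C_Poly a b \<delta> \<gamma> < \<infinity> \<longrightarrow>
            wce (poly_lattice s g f) a b s \<gamma> \<phi>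
              \<le> 2 * C_Poly a b \<delta> \<gamma> / ereal (2 powr (real m * (1 - \<delta>)))) \<and>
         (summable (\<lambda>i. S_term a b \<gamma> (i + 1)) \<longrightarrow>
            (\<forall>\<delta>\<in>{0<..<min 1 (5 * S_sum a b \<gamma> / ln 2)}. \<forall>n::nat.
               (\<Sum>i. S_term a b \<gamma> (i + n + 1)) < \<delta> * ln 2 / 5 \<longrightarrow>
               wce (poly_lattice s g f) a b s \<gamma> \<phi>
                 \<le> ereal (C_Poly_prod a b \<delta> \<gamma> n / 2 powr (real m * (1 - \<delta>)))))"
proof -
  interpret box_densities a b \<phi> by unfold_locales fact+
  define A where "A = (\<Sum>i\<in>{1..s}. \<gamma> {i} * (b i - a i)) +
    (\<Sum>u\<in>Pow {1..s} - {{}}. \<gamma> u * (\<Prod>i\<in>u. b i - a i) * (real m / 2) ^ card u)"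
  have wce: "wce (poly_lattice s g f) a b s \<gamma> \<phi> \<le> ereal (A / 2 ^ m)"
    unfolding A_def by (rule wce_cbc_bound) fact+
  have \<gamma>_pos: "\<gamma> u > 0" if "u \<subseteq> {1..s}" for u
    using that finite_subset[OF that] by (intro assms(4)) auto
  have width: "0 < b i - a i" if "i \<in> {1..s}" for i using that assms(1)[of i] by simp
  \<comment> \<open>Both parts reduce to this: \<open>A\<close> may exceed the constant by a factor
    of at most 2^(m \<delta>).\<close>
  have wce_le: "wce (poly_lattice s g f) a b s \<gamma> \<phi> \<le> ereal (C / 2 powr (real m * (1 - \<delta>)))"
    if "A \<le> C * 2 powr (real m * \<delta>)" for C \<delta>
  proof -
    have "2 powr (real m * (1 - \<delta>)) = 2 ^ m / 2 powr (real m * \<delta>)"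
      by (simp add: right_diff_distrib powr_diff powr_realpow)
    then have "A / 2 ^ m \<le> C / 2 powr (real m * (1 - \<delta>))"
      using that by (simp add: divide_right_mono)
    then show ?thesis using wce by (meson ereal_less_eq(3) order_trans)
  qed
  show ?thesis
  proof (intro conjI ballI impI allI)
    fix \<delta> :: real assume \<delta>: "\<delta> \<in> {0<..<1}" and fin: "C_Poly a b \<delta> \<gamma> < \<infinity>"
    let ?c = "\<lambda>u. max 2 (real (card u) / (exp 1 * \<delta> * 2 * ln 2))"
    define T where "T = (\<Sum>u\<in>Pow {1..s} - {{}}. \<gamma> u * (\<Prod>i\<in>u. ?c u * (b i - a i)))"
    have T_le: "ereal T \<le> C_Poly a b \<delta> \<gamma>"
      unfolding C_Poly_def T_def using \<open>s \<ge> 1\<close> by (intro SUP_upper2[of s]) auto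
    then obtain C where C: "C_Poly a b \<delta> \<gamma> = ereal C" "T \<le> C"
      using fin by (cases "C_Poly a b \<delta> \<gamma>") auto
    have single: "(\<Sum>i\<in>{1..s}. \<gamma> {i} * (b i - a i)) \<le> T"
    proof -
      have "(\<Sum>i\<in>{1..s}. \<gamma> {i} * (b i - a i)) \<le> (\<Sum>i\<in>{1..s}. \<gamma> {i} * (?c {i} * (b i - a i)))"
      proof (intro sum_mono mult_left_mono)
        fix i assume i: "i \<in> {1..s}"
        \<comment> \<open>The maximum with 2 keeps the factor above 1, so the quadrature terms are
          dominated by the singleton terms of \<open>T\<close>.\<close>
        have "1 * (b i - a i) \<le> ?c {i} * (b i - a i)" using width[OF i] by (intro mult_right_mono) auto
        then show "b i - a i \<le> ?c {i} * (b i - a i)" by simp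
        show "0 \<le> \<gamma> {i}" using \<gamma>_pos[of "{i}"] i by simp
      qed
      also have "\<dots> = (\<Sum>u\<in>(\<lambda>i. {i}) ` {1..s}. \<gamma> u * (\<Prod>i\<in>u. ?c u * (b i - a i)))"
        by (subst sum.reindex) (auto simp: inj_on_def)
      also have "\<dots> \<le> T"
        unfolding T_def
      proof (rule sum_mono2)
        fix u assume "u \<in> Pow {1..s} - {{}} - (\<lambda>i. {i}) ` {1..s}"
        then have u: "u \<subseteq> {1..s}" by auto
        have "0 \<le> (\<Prod>i\<in>u. ?c u * (b i - a i))"
        proof (rule prod_nonneg)
          fix i assume "i \<in> u"
          then have "0 < b i - a i" using width u by blast
          then show "0 \<le> ?c u * (b i - a i)" by (intro mult_nonneg_nonneg) auto
        qed
        then show "0 \<le> \<gamma> u * (\<Prod>i\<in>u. ?c u * (b i - a i))" using \<gamma>_pos[OF u] by simp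
      qed auto
      finally show ?thesis .
    qed
    have "0 \<le> (\<Sum>i\<in>{1..s}. \<gamma> {i} * (b i - a i))"
      using width \<gamma>_pos by (intro sum_nonneg mult_nonneg_nonneg less_imp_le) auto
    then have "0 \<le> T" using single by simp
    have "(\<Sum>u\<in>Pow {1..s} - {{}}. \<gamma> u * (\<Prod>i\<in>u. b i - a i) * (real m / 2) ^ card u) \<le> T * 2 powr (real m * \<delta>)"
      unfolding T_def sum_distrib_right
    proof (rule sum_mono)
      fix u assume "u \<in> Pow {1..s} - {{}}"
      then have u: "u \<subseteq> {1..s}" "u \<noteq> {}" by auto
      then have "card u \<ge> 1" using finite_subset[OF u(1)] by (simp add: Suc_le_eq card_gt_0_iff)
      have "0 \<le> (\<Prod>i\<in>u. b i - a i)" 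
        using width u by (intro prod_nonneg less_imp_le[OF width]) (rule subsetD)
      then have "\<gamma> u * (\<Prod>i\<in>u. b i - a i) * (real m / 2) ^ card u \<le>
          \<gamma> u * (\<Prod>i\<in>u. b i - a i) * (?c u ^ card u * 2 powr (real m * \<delta>))"
        using \<gamma>_pos[OF u(1)] \<delta> \<open>card u \<ge> 1\<close> by (intro mult_left_mono power_half_le_max) auto
      then show "\<gamma> u * (\<Prod>i\<in>u. b i - a i) * (real m / 2) ^ card u \<le>
          \<gamma> u * (\<Prod>i\<in>u. ?c u * (b i - a i)) * 2 powr (real m * \<delta>)"
        by (simp add: prod.distrib mult_ac)
    qed
    moreover have "T * 1 \<le> T * 2 powr (real m * \<delta>)"
      using \<open>0 \<le> T\<close> \<delta> by (intro mult_left_mono ge_one_powr_ge_zero) auto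
    moreover have "T * 2 powr (real m * \<delta>) \<le> C * 2 powr (real m * \<delta>)"
      using C(2) by (intro mult_right_mono) auto
    \<comment> \<open>One copy of \<open>C\<close> pays for the quadrature error, the other for the
      figure of merit.\<close>
    ultimately have "A \<le> (2 * C) * 2 powr (real m * \<delta>)"
      unfolding A_def using single by linarith
    from wce_le[OF this] show "wce (poly_lattice s g f) a b s \<gamma> \<phi>
        \<le> 2 * C_Poly a b \<delta> \<gamma> / ereal (2 powr (real m * (1 - \<delta>)))"
      by (simp add: C(1))
  next
    fix \<delta> :: real and n :: nat
    assume sm: "summable (\<lambda>i. S_term a b \<gamma> (i + 1))"
      and \<delta>: "\<delta> \<in> {0<..<min 1 (5 * S_sum a b \<gamma> / ln 2)}"
      and tail: "(\<Sum>i. S_term a b \<gamma> (i + n + 1)) < \<delta> * ln 2 / 5"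
    let ?\<beta> = "S_term a b \<gamma>"
    define D where "D = \<delta> * ln 2 / 5"
    \<comment> \<open>The upper bound 5 S / ln 2 on \<delta> says exactly that \<open>D\<close> is
      below the full series, so that the ratio of the two is at least 1.\<close>
    have D: "0 < D" "D \<le> (\<Sum>i. ?\<beta> (i + 1))" using \<delta> by (auto simp: D_def S_sum_def field_simps)
    have \<beta>: "0 \<le> ?\<beta> i" if "i \<ge> 1" for i by (rule S_term_nonneg[OF assms(1,4) that])
    have weight: "\<gamma> u * (\<Prod>i\<in>u. b i - a i) \<le> (\<Prod>i\<in>u. ?\<beta> i)" if "u \<subseteq> {1..s}" "u \<noteq> {}" for u
    proof -
      have "(\<gamma>({} := 1)) u * (\<Prod>i\<in>u. b i - a i) \<le> (\<Prod>i\<in>u. ?\<beta> i)"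
        using that(1) finite_subset[OF that(1)]
        by (intro weight_le_prod_S_term assms(1,4)) auto
      then show ?thesis using that(2) by simp
    qed
    have "(\<Sum>i\<in>{1..s}. \<gamma> {i} * (b i - a i)) \<le> (\<Sum>i\<in>{1..s}. ?\<beta> i)"
    proof (rule sum_mono)
      fix i assume "i \<in> {1..s}"
      then show "\<gamma> {i} * (b i - a i) \<le> ?\<beta> i" using weight[of "{i}"] by simp
    qed
    moreover have "(\<Sum>u\<in>Pow {1..s} - {{}}. \<gamma> u * (\<Prod>i\<in>u. b i - a i) * (real m / 2) ^ card u) \<le>
        (\<Sum>u\<in>Pow {1..s} - {{}}. (\<Prod>i\<in>u. ?\<beta> i) * (real m / 2) ^ card u)"
      by (intro sum_mono mult_right_mono weight) auto
    \<comment> \<open>The subtracted 1 is the term of the empty set.\<close>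
    moreover have "\<dots> = (\<Prod>i\<in>{1..s}. 1 + ?\<beta> i * (real m / 2)) - 1"
      by (subst sum_diff1) (simp_all add: sum_prod_Pow)
    ultimately have "A \<le> (\<Sum>i\<in>{1..s}. ?\<beta> i) + (\<Prod>i\<in>{1..s}. 1 + ?\<beta> i * (real m / 2))"
      unfolding A_def by linarith
    also have "\<dots> \<le> (\<Prod>i\<in>{1..s}. 1 + ?\<beta> i * (1 + real m / 2))"
      using \<beta> by (intro sum_add_prod_le) auto
    also have "\<dots> \<le> ((\<Sum>i. ?\<beta> (i + 1)) / D) ^ n * exp (2 * D * (1 + real m / 2))"
      using tail \<beta> by (intro prod_one_plus_le_power_exp sm D) (auto simp: D_def)
    also have "\<dots> \<le> ((\<Sum>i. ?\<beta> (i + 1)) / D) ^ n * 2 powr (real m * \<delta>)"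
    proof (rule mult_left_mono)
      \<comment> \<open>Irreducible polynomials are nonconstant, hence 1 + m/2 <= 5m/2; with the 5
        in the denominator of \<open>D\<close> the exponent becomes m \<delta> ln 2.\<close>
      have "m \<ge> 1" using degree_irreducible_pos[OF assms(6)] assms(7) by simp
      then have "2 * D * (1 + real m / 2) \<le> 2 * D * (5 / 2 * real m)"
        using D(1) by (intro mult_left_mono) auto
      also have "\<dots> = real m * \<delta> * ln 2" by (simp add: D_def)
      finally show "exp (2 * D * (1 + real m / 2)) \<le> 2 powr (real m * \<delta>)"
        by (simp add: powr_def)
      show "0 \<le> ((\<Sum>i. ?\<beta> (i + 1)) / D) ^ n" using D by simp
    qed
    also have "((\<Sum>i. ?\<beta> (i + 1)) / D) ^ n = C_Poly_prod a b \<delta> \<gamma> n"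
      by (simp add: C_Poly_prod_def S_sum_def D_def mult.commute)
    finally show "wce (poly_lattice s g f) a b s \<gamma> \<phi>
        \<le> ereal (C_Poly_prod a b \<delta> \<gamma> n / 2 powr (real m * (1 - \<delta>)))"
      by (rule wce_le)
  qed
qed

end
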